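(* (i) Let G be an abelian group of order 9m^4, where m is a positive odd integer with gcd(3,m)=1. If there exists a (9m^4, r(3m^2+1), -3m^2+r^2+3r, r^2+r) negative Latin square type partial difference set in G with r ≤ (3m^2-1)/2, then r ∈ {(3m^2-3)/4, (3m^2+1)/4, (3m^2+5)/4, (3m^2-5)/2, (3m^2-3)/2, (3m^2-1)/2}. (ii) Let G be an abelian group of order 9p^{4s}, where p is a prime with p ≡ 1 (mod 4) and s is an odd positive integer. If there exists a (9p^{4s}, r(3p^{2s}+1), -3p^{2s}+r^2+3r, r^2+r) negative Latin square type partial difference set in G with r ≤ (3p^{2s}-1)/2, then r ∈ {(3p^{2s}+1)/4, (3p^{2s}-1)/2, (3p^{2s}-3)/2}.
   Context: A subset D of a finite abelian group G is a (v,k,λ,μ) partial difference set (PDS) if |G|=v, |D|=k, and the differences gh^{-1} with g,h∈D distinct represent each non-identity element of D exactly λ times and each non-identity element of G not in D exactly μ times. A negative Latin square type PDS has parameters (n^2, r(n+1), -n+r^2+3r, r^2+r). The paper considers regular PDSs (D^{(-1)}=D, identity not in D); since the complement of a negative Latin square type PDS is again of that type, one may restrict to 1 ≤ r ≤ (n-1)/2. *)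

theory Defs
  imports "HOL-Algebra.Algebra"
begin

definition pds :: "('a, 'b) monoid_scheme \<Rightarrow> 'a set \<Rightarrow> int \<Rightarrow> int \<Rightarrow> int \<Rightarrow> int \<Rightarrow> bool" where
  "pds G D v k lam mu \<longleftrightarrow>
     D \<subseteq> carrier G \<and> int (card (carrier G)) = v \<and> int (card D) = k \<and>
     (\<forall>x \<in> carrier G - {\<one>\<^bsub>G\<^esub>}.
        int (card {(g, h). g \<in> D \<and> h \<in> D \<and> g \<noteq> h \<and> g \<otimes>\<^bsub>G\<^esub> inv\<^bsub>G\<^esub> h = x})
          = (if x \<in> D then lam else mu))"

definition regular_pds :: "('a, 'b) monoid_scheme \<Rightarrow> 'a set \<Rightarrow> int \<Rightarrow> int \<Rightarrow> int \<Rightarrow> int \<Rightarrow> bool" where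
  "regular_pds G D v k lam mu \<longleftrightarrow>
     pds G D v k lam mu \<and> \<one>\<^bsub>G\<^esub> \<notin> D \<and> (\<forall>x \<in> D. inv\<^bsub>G\<^esub> x \<in> D)"

definition nls_pds :: "('a, 'b) monoid_scheme \<Rightarrow> 'a set \<Rightarrow> int \<Rightarrow> int \<Rightarrow> bool" where
  "nls_pds G D n r \<longleftrightarrow> regular_pds G D (n^2) (r * (n + 1)) (- n + r^2 + 3 * r) (r^2 + r)"

end

theory Submission
  imports Defs "HOL-Number_Theory.Residues"
begin

text \<open>
  Write \<open>w = m\<^sup>2\<close>, \<open>n = 3 w\<close> and \<open>G = P \<times> Q\<close> with \<open>|P| = 9\<close> and \<open>|Q| = w\<^sup>2\<close>. Every nontrivial character
  of \<open>G\<close> takes the value \<open>r\<close> or \<open>r - n\<close> on \<open>D\<close>. For a nontrivial character \<open>\<eta>\<close> of \<open>Q\<close> let \<open>b\<close> be the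
  number of characters \<open>\<psi>\<close> of \<open>P\<close> with \<open>(\<psi>\<eta>)(D) = r - n\<close>, and let \<open>c \<in> {0, 1}\<close> tell whether the
  trivial \<open>\<psi>\<close> is one of them. Then \<open>\<eta>(D \<inter> Q) = r - w b / 3\<close> is a rational cyclotomic integer, so
  \<open>3\<close> divides \<open>b\<close>; and \<open>(\<psi>\<eta>)(D) = (\<psi>\<^sup>-\<^sup>1\<eta>)(D)\<close> by the multiplier theorem, so \<open>b\<close> and \<open>c\<close> have the same
  parity. Hence \<open>b\<^sup>2 - 6 b + 9 c \<ge> 0\<close>. The sum of this inequality over all \<open>\<eta> \<noteq> 1\<close> is evaluated by
  orthogonality and forces \<open>3 w \<le> 2 r + 3\<close>. As \<open>w\<close> is odd, only \<open>r = (3 w - 1) / 2\<close> and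
  \<open>r = (3 w - 3) / 2\<close> remain, in both parts of the theorem.
\<close>

subsection \<open>Rational cyclotomic integers\<close>

text \<open>For \<open>N > 0\<close> this is the ring Z[\<zeta>] of a primitive \<open>N\<close>-th
  root of unity \<zeta>, encoded as the additive group generated by all \<open>N\<close>-th roots of
  unity. Closure under differences gives 0, negatives and sums; products of generators are
  generators.\<close>

inductive_set cyclotomic_integers :: "nat \<Rightarrow> complex set" for N :: nat where
  root: "z ^ N = 1 \<Longrightarrow> z \<in> cyclotomic_integers N"
| diff: "x \<in> cyclotomic_integers N \<Longrightarrow> y \<in> cyclotomic_integers N \<Longrightarrow> x - y \<in> cyclotomic_integers N"

lemma cyclotomic_integers_1: "1 \<in> cyclotomic_integers N"
  by (rule cyclotomic_integers.root) simp

lemma cyclotomic_integers_0: "0 \<in> cyclotomic_integers N"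
  using cyclotomic_integers.diff[OF cyclotomic_integers_1 cyclotomic_integers_1] by simp

lemma cyclotomic_integers_minus: "x \<in> cyclotomic_integers N \<Longrightarrow> - x \<in> cyclotomic_integers N"
  using cyclotomic_integers.diff[OF cyclotomic_integers_0] by force

lemma cyclotomic_integers_add:
  "x \<in> cyclotomic_integers N \<Longrightarrow> y \<in> cyclotomic_integers N \<Longrightarrow> x + y \<in> cyclotomic_integers N"
  using cyclotomic_integers.diff[OF _ cyclotomic_integers_minus] by force

lemma cyclotomic_integers_mult:
  assumes "x \<in> cyclotomic_integers N" "y \<in> cyclotomic_integers N"
  shows "x * y \<in> cyclotomic_integers N"
  using assms(1)
proof induction
  case (root z)
  from assms(2) show ?case
  proof induction
    case (root z')
    with \<open>z ^ N = 1\<close> show ?case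
      by (intro cyclotomic_integers.root) (simp add: power_mult_distrib)
  qed (simp add: right_diff_distrib cyclotomic_integers.diff)
qed (simp add: left_diff_distrib cyclotomic_integers.diff)

lemma cyclotomic_integers_power:
  "x \<in> cyclotomic_integers N \<Longrightarrow> x ^ k \<in> cyclotomic_integers N"
  by (induction k) (simp_all add: cyclotomic_integers_1 cyclotomic_integers_mult)

lemma cyclotomic_integers_sum:
  "(\<And>i. i \<in> A \<Longrightarrow> f i \<in> cyclotomic_integers N) \<Longrightarrow> sum f A \<in> cyclotomic_integers N"
  by (induction A rule: infinite_finite_induct)
     (simp_all add: cyclotomic_integers_0 cyclotomic_integers_add)

lemma cyclotomic_integers_of_nat: "of_nat k \<in> cyclotomic_integers N"
  by (induction k) (simp_all add: cyclotomic_integers_0 cyclotomic_integers_1 cyclotomic_integers_add)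

text \<open>Extend {1} to a basis of the complex numbers over the rationals and take the linear map
  prescribed as 1 on that vector. It retracts the complex numbers onto the rationals.\<close>

lemma rational_linear_functional:
  obtains f :: "complex \<Rightarrow> rat"
  where "\<And>x y. f (x - y) = f x - f y" and "\<And>q x. f (of_rat q * x) = q * f x" and "f 1 = 1"
proof -
  interpret vector_space_pair "\<lambda>(q::rat) (z::complex). of_rat q * z" "\<lambda>(q::rat) (z::rat). q * z"
    by unfold_locales (simp_all add: algebra_simps of_rat_add of_rat_mult)
  have "vs1.independent {1}"
    by (simp add: vs1.dependent_single)
  from linear_independent_extend[OF this, of "\<lambda>_. 1"]
  obtain f where "Vector_Spaces.linear (\<lambda>(q::rat) (z::complex). of_rat q * z) (*) f" and 1: "f 1 = 1"
    by auto
  then interpret f: Vector_Spaces.linear "\<lambda>(q::rat) (z::complex). of_rat q * z" "(*)" f by simp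
  show thesis
    using that[of f] f.diff f.scale 1 by simp
qed

text \<open>In lowest terms a/b, every power of b would have to divide the fixed nonzero
  \<open>M\<close>, so b = 1.\<close>

lemma bounded_denominator_powers_Ints:
  fixes q :: rat and M :: int
  assumes "M \<noteq> 0" and int: "\<And>k::nat. of_int M * q ^ k \<in> \<int>"
  shows "q \<in> \<int>"
proof -
  obtain a b where ab: "quotient_of q = (a, b)" by force
  have b: "b > 0" and co: "coprime a b" and q: "q = of_int a / of_int b"
    using quotient_of_denom_pos[OF ab] quotient_of_coprime[OF ab] quotient_of_div[OF ab] by auto
  have dvd: "b ^ k dvd M" for k
  proof -
    obtain c where "of_int M * q ^ k = of_int c"
      using int[of k] by (auto elim: Ints_cases)
    hence "(of_int (M * a ^ k) :: rat) = of_int (c * b ^ k)"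
      using b by (simp add: q power_divide field_simps)
    hence "b ^ k dvd M * a ^ k"
      by (simp only: of_int_eq_iff) simp
    thus ?thesis
      using co by (simp add: coprime_dvd_mult_left_iff coprime_commute)
  qed
  have "b = 1"
  proof (rule ccontr)
    assume "b \<noteq> 1"
    hence "2 \<le> b" using b by simp
    \<comment> \<open>The exponent |M| already suffices for a contradiction, since 2 to the |M|
      exceeds |M|.\<close>
    hence "(2::int) ^ nat \<bar>M\<bar> \<le> b ^ nat \<bar>M\<bar>"
      by (intro power_mono) auto
    also have "\<dots> \<le> \<bar>M\<bar>"
      using dvd_imp_le_int[OF assms(1) dvd[of "nat \<bar>M\<bar>"]] b by simp
    finally have "(2::int) ^ nat \<bar>M\<bar> \<le> int (nat \<bar>M\<bar>)" by simp
    moreover have "int (nat \<bar>M\<bar>) < 2 ^ nat \<bar>M\<bar>"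
      by (rule of_nat_less_two_power)
    ultimately show False by simp
  qed
  thus ?thesis using q by simp
qed

text \<open>A rational functional has bounded denominators on the finitely generated group
  of cyclotomic integers, hence on all powers of a rational element.\<close>

lemma rational_cyclotomic_integer_Ints:
  fixes q :: rat
  assumes N: "N > 0" and q: "of_rat q \<in> cyclotomic_integers N"
  shows "q \<in> \<int>"
proof -
  obtain f :: "complex \<Rightarrow> rat" where f_diff: "\<And>x y. f (x - y) = f x - f y"
    and f_scale: "\<And>q x. f (of_rat q * x) = q * f x" and f1: "f 1 = 1"
    using rational_linear_functional by blast
  define R where "R = {z::complex. z ^ N = 1}"
  have R: "finite R" unfolding R_def using N by (intro finite_nth_roots) auto
  \<comment> \<open>A common denominator of \<open>f\<close> on the finitely many generators; by
    additivity it then serves for all cyclotomic integers.\<close>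
  define M where "M = (\<Prod>z\<in>R. snd (quotient_of (f z)))"
  have M: "M \<noteq> 0"
    unfolding M_def using R quotient_of_denom_pos' by (simp add: less_imp_neq[symmetric])
  have "of_int M * f z \<in> \<int>" if "z \<in> cyclotomic_integers N" for z
    using that
  proof induction
    case (root z)
    hence z: "z \<in> R" by (simp add: R_def)
    have "M = snd (quotient_of (f z)) * (\<Prod>y\<in>R - {z}. snd (quotient_of (f y)))"
      unfolding M_def using R z by (rule prod.remove)
    moreover have "of_int (snd (quotient_of (f z))) * f z = of_int (fst (quotient_of (f z)))"
      using quotient_of_div[OF prod.collapse[symmetric], of "f z"] quotient_of_denom_pos'[of "f z"]
      by (metis less_irrefl nonzero_mult_div_cancel_left of_int_0_eq_iff times_divide_eq_right)
    ultimately have "of_int M * f z =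
        of_int (fst (quotient_of (f z)) * (\<Prod>y\<in>R - {z}. snd (quotient_of (f y))))"
      by (simp only: of_int_mult) (simp add: mult_ac)
    thus ?case by (metis Ints_of_int)
  next
    case (diff x y)
    thus ?case by (simp add: f_diff right_diff_distrib)
  qed
  hence "of_int M * f (of_rat (q ^ k)) \<in> \<int>" for k
    using cyclotomic_integers_power[OF q, of k] by (simp add: of_rat_power)
  moreover have "f (of_rat (q ^ k)) = q ^ k" for k
    using f_scale[of "q ^ k" 1] f1 by simp
  ultimately have "of_int M * q ^ k \<in> \<int>" for k
    by simp
  with M show ?thesis by (rule bounded_denominator_powers_Ints)
qed

text \<open>The inner binomial coefficients are divisible by \<open>p\<close>; dividing them by
  \<open>p\<close> gives the witness \<open>c\<close>.\<close>

lemma cyclotomic_integers_frobenius_add: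
  assumes p: "Factorial_Ring.prime p"
    and x: "x \<in> cyclotomic_integers N" and y: "y \<in> cyclotomic_integers N"
  shows "\<exists>c\<in>cyclotomic_integers N. (x + y) ^ p = x ^ p + y ^ p + of_nat p * c"
proof -
  have p0: "p > 0" using p by (simp add: prime_gt_0_nat)
  define c where "c = (\<Sum>k=1..<p. of_nat ((p choose k) div p) * x ^ k * y ^ (p - k))"
  have "c \<in> cyclotomic_integers N"
    unfolding c_def using x y
    by (intro cyclotomic_integers_sum cyclotomic_integers_mult cyclotomic_integers_power
        cyclotomic_integers_of_nat)
  moreover have "(x + y) ^ p = x ^ p + y ^ p + of_nat p * c"
  proof -
    have "{..p} = insert 0 (insert p {1..<p})" using p0 by auto
    hence "(x + y) ^ p = y ^ p + (x ^ p + (\<Sum>k=1..<p. of_nat (p choose k) * x ^ k * y ^ (p - k)))"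
      using p0 by (simp add: binomial_ring)
    also have "(\<Sum>k=1..<p. of_nat (p choose k) * x ^ k * y ^ (p - k)) = of_nat p * c"
      unfolding c_def sum_distrib_left
    proof (rule sum.cong[OF refl])
      fix k assume "k \<in> {1..<p}"
      hence "p dvd (p choose k)" using p by (intro dvd_choose_prime) auto
      hence "of_nat (p choose k) = (of_nat p * of_nat ((p choose k) div p) :: complex)"
        by (metis dvd_mult_div_cancel of_nat_mult)
      thus "of_nat (p choose k) * x ^ k * y ^ (p - k) =
          of_nat p * (of_nat ((p choose k) div p) * x ^ k * y ^ (p - k))"
        by (simp add: mult.assoc)
    qed
    finally show ?thesis by simp
  qed
  ultimately show ?thesis by blast
qed

lemma cyclotomic_integers_frobenius_sum:
  assumes p: "Factorial_Ring.prime p" and "finite A"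
    and "\<And>i. i \<in> A \<Longrightarrow> f i \<in> cyclotomic_integers N"
  shows "\<exists>c\<in>cyclotomic_integers N. sum f A ^ p = (\<Sum>i\<in>A. f i ^ p) + of_nat p * c"
  using assms(2,3)
proof (induction A)
  case empty
  show ?case using p by (auto simp: prime_gt_0_nat intro!: bexI[OF _ cyclotomic_integers_0])
next
  case (insert a A)
  then obtain c where c: "c \<in> cyclotomic_integers N" "sum f A ^ p = (\<Sum>i\<in>A. f i ^ p) + of_nat p * c"
    by auto
  obtain d where d: "d \<in> cyclotomic_integers N"
    "(f a + sum f A) ^ p = f a ^ p + sum f A ^ p + of_nat p * d"
    using cyclotomic_integers_frobenius_add[OF p, of "f a" N "sum f A"] insert
    by (auto intro: cyclotomic_integers_sum)
  show ?case
    using insert.hyps c d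
    by (intro bexI[of _ "c + d"]) (auto simp: algebra_simps intro: cyclotomic_integers_add)
qed

text \<open>Fermat's little theorem for integers of either sign, as needed for the possibly negative
  value \<open>r - n\<close>. The base is replaced by its residue modulo \<open>p\<close>.\<close>

lemma prime_dvd_int_power_diff:
  fixes a :: int
  assumes "Factorial_Ring.prime p"
  shows "int p dvd a ^ p - a"
proof (cases "int p dvd a")
  case True
  thus ?thesis using assms by (simp add: dvd_power prime_gt_0_nat dvd_trans)
next
  case False
  define b where "b = nat (a mod int p)"
  have p0: "p > 0" using assms by (simp add: prime_gt_0_nat)
  have b: "[int b = a] (mod int p)" using p0 by (simp add: b_def cong_def)
  with False have "\<not> p dvd b" by (metis cong_dvd_iff cong_sym int_dvd_int_iff)
  hence "[b ^ (p - 1) * b = 1 * b] (mod p)"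
    using assms by (intro cong_mult fermat_theorem) auto
  hence "[b ^ p = b] (mod p)"
    using p0 by (simp only: power_minus_mult mult_1)
  hence "[int b ^ p = int b] (mod int p)"
    by (simp flip: cong_int_iff)
  hence "[a ^ p = a] (mod int p)"
    using b by (metis cong_pow cong_sym cong_trans)
  thus ?thesis by (simp add: cong_iff_dvd_diff)
qed

text \<open>The orbits \<open>{x, f x}\<close> all have two elements; the induction removes one
  orbit at a time.\<close>

lemma card_even_involution:
  assumes "finite A" "\<And>x. x \<in> A \<Longrightarrow> f x \<in> A" "\<And>x. x \<in> A \<Longrightarrow> f (f x) = x"
    "\<And>x. x \<in> A \<Longrightarrow> f x \<noteq> x"
  shows "even (card A)"
  using assms
proof (induction "card A" arbitrary: A rule: less_induct)
  case less
  show ?case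
  proof (cases "A = {}")
    case False
    then obtain x where x: "x \<in> A" by blast
    let ?B = "A - {x, f x}"
    have fx: "f x \<in> A" "f x \<noteq> x" "f (f x) = x" using x less.prems by auto
    have "card {x, f x} = 2" "{x, f x} \<subseteq> A" using x fx by auto
    hence c: "card A = card ?B + 2"
      using less.prems(1) by (metis card_Diff_subset card_mono finite.emptyI finite_insert le_add_diff_inverse2)
    have "even (card ?B)"
    proof (rule less.hyps)
      show "f y \<in> ?B" if "y \<in> ?B" for y
        using that less.prems(2)[of y] less.prems(3)[of y] fx by auto
    qed (use c less.prems in auto)
    thus ?thesis using c by simp
  qed simp
qed

subsection \<open>Characters of finite abelian groups\<close>

definition mult_character :: "('a, 'b) monoid_scheme \<Rightarrow> ('a \<Rightarrow> complex) \<Rightarrow> bool" where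
  "mult_character G \<chi> \<longleftrightarrow>
     \<chi> \<one>\<^bsub>G\<^esub> = 1 \<and> (\<forall>x\<in>carrier G. \<forall>y\<in>carrier G. \<chi> (x \<otimes>\<^bsub>G\<^esub> y) = \<chi> x * \<chi> y)"

text \<open>Extensionality fixes the values off the carrier, so that each character is represented
  by exactly one function and the set can be counted.\<close>

definition characters :: "('a, 'b) monoid_scheme \<Rightarrow> ('a \<Rightarrow> complex) set" where
  "characters G = {\<chi> \<in> extensional (carrier G). mult_character G \<chi>}"

definition principal_character :: "('a, 'b) monoid_scheme \<Rightarrow> 'a \<Rightarrow> complex" where
  "principal_character G = restrict (\<lambda>_. 1) (carrier G)"

context group
begin

lemma mult_character_pow:
  assumes "mult_character G \<chi>" "x \<in> carrier G"
  shows "\<chi> (x [^] (k::nat)) = \<chi> x ^ k"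
  using assms by (induction k) (simp_all add: mult_character_def)

lemma mult_character_power_order:
  assumes "mult_character G \<chi>" "x \<in> carrier G"
  shows "\<chi> x ^ order G = 1"
  using assms mult_character_pow[OF assms, of "order G"]
  by (simp add: pow_order_eq_1 mult_character_def)

lemma mult_character_inv:
  assumes "mult_character G \<chi>" "x \<in> carrier G"
  shows "\<chi> x * \<chi> (inv x) = 1"
  using assms unfolding mult_character_def by (metis inv_closed r_inv)

text \<open>Translation by \<open>a\<close> permutes the group and multiplies the sum by
  \<open>\<chi> a\<close>, which is not 1.\<close>

lemma sum_mult_character_eq_0:
  assumes \<chi>: "mult_character G \<chi>" and a: "a \<in> carrier G" "\<chi> a \<noteq> 1"
  shows "sum \<chi> (carrier G) = 0"
proof -
  have "bij_betw (\<lambda>x. a \<otimes> x) (carrier G) (carrier G)"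
    by (rule bij_betw_byWitness[where f' = "\<lambda>x. inv a \<otimes> x"])
       (use a in \<open>auto simp: m_assoc[symmetric]\<close>)
  hence "sum \<chi> (carrier G) = (\<Sum>x\<in>carrier G. \<chi> (a \<otimes> x))"
    by (rule sum.reindex_bij_betw[symmetric])
  also have "\<dots> = \<chi> a * sum \<chi> (carrier G)"
    using \<chi> a by (simp add: mult_character_def sum_distrib_left)
  finally show ?thesis using a(2) by (simp add: algebra_simps)
qed

end

context comm_group
begin

text \<open>The extension sends \<open>k \<otimes> x [^] i\<close> to \<open>f k * z ^ i\<close>. By
  minimality of \<open>d\<close>, the power \<open>x [^] i\<close> lies in \<open>K\<close> only
  when \<open>d\<close> divides \<open>i\<close>, and there the equation for \<open>z\<close> makes
  both prescriptions agree.\<close>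

lemma mult_character_extend:
  fixes d :: nat
  assumes fin: "finite (carrier G)" and K: "subgroup K G"
    and f: "mult_character (G\<lparr>carrier := K\<rparr>) f"
    and x: "x \<in> carrier G" and d: "0 < d" "x [^] d \<in> K"
    and least: "\<And>i::nat. 0 < i \<Longrightarrow> i < d \<Longrightarrow> x [^] i \<notin> K"
    and z: "z ^ d = f (x [^] d)"
  shows "\<exists>K' f'. subgroup K' G \<and> K \<subseteq> K' \<and> x \<in> K' \<and> mult_character (G\<lparr>carrier := K'\<rparr>) f' \<and>
    (\<forall>k\<in>K. f' k = f k) \<and> f' x = z"
proof -
  have KG: "k \<in> carrier G" if "k \<in> K" for k using subgroup.mem_carrier[OF K that] .
  have Kclosed: "a \<otimes> b \<in> K" if "a \<in> K" "b \<in> K" for a b using subgroup.m_closed[OF K that] .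
  have Kinv: "inv a \<in> K" if "a \<in> K" for a using subgroup.m_inv_closed[OF K that] .
  have f1: "f \<one> = 1" and fm: "f (a \<otimes> b) = f a * f b" if "a \<in> K" "b \<in> K" for a b
    using f that by (auto simp: mult_character_def)
  have 1: "\<one> \<in> K" using subgroup.one_closed[OF K] .
  have pow: "(x [^] d) [^] q \<in> K \<and> f ((x [^] d) [^] q) = f (x [^] d) ^ q" for q :: nat
    by (induction q) (simp_all add: 1 f1[OF 1 1] Kclosed fm d)
  have xpow: "f (x [^] i) = z ^ i" if "x [^] i \<in> K" for i :: nat
  proof -
    have e: "x [^] i = (x [^] d) [^] (i div d) \<otimes> x [^] (i mod d)"
      using x by (simp add: nat_pow_pow nat_pow_mult)
    \<comment> \<open>The remainder power lies in \<open>K\<close> as well, so minimality of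
      \<open>d\<close> forces the remainder to be 0.\<close>
    have "x [^] (i mod d) = inv ((x [^] d) [^] (i div d)) \<otimes> x [^] i"
      using x by (simp add: e m_assoc[symmetric])
    also have "\<dots> \<in> K" using that pow by (intro Kclosed Kinv) auto
    finally have "i mod d = 0" using least[of "i mod d"] d by auto
    hence i: "i = d * (i div d)" by auto
    have "f (x [^] i) = f ((x [^] d) [^] (i div d))"
      using i x by (metis nat_pow_pow)
    also have "\<dots> = z ^ i" using pow z i by (metis power_mult)
    finally show ?thesis .
  qed
  have wd1: "f k * z ^ i = f k' * z ^ j"
    if "k \<in> K" "k' \<in> K" "k \<otimes> x [^] i = k' \<otimes> x [^] j" "i \<le> j" for k k' and i j :: nat
  proof -
    have "k \<otimes> x [^] i = (k' \<otimes> x [^] (j - i)) \<otimes> x [^] i"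
      using that x KG by (simp add: m_assoc nat_pow_mult)
    hence k: "k = k' \<otimes> x [^] (j - i)"
      using that x KG by simp
    hence "x [^] (j - i) = inv k' \<otimes> k"
      using that x KG by (simp add: m_assoc[symmetric])
    hence "x [^] (j - i) \<in> K" using that by (simp add: Kclosed Kinv)
    hence "f k = f k' * z ^ (j - i)" using k that by (simp add: fm xpow)
    thus ?thesis using that(4) by (simp add: mult.assoc flip: power_add)
  qed
  have wd: "f k * z ^ i = f k' * z ^ j"
    if "k \<in> K" "k' \<in> K" "k \<otimes> x [^] i = k' \<otimes> x [^] j" for k k' and i j :: nat
    using wd1[of k k' i j] wd1[of k' k j i] that by (cases "i \<le> j") auto
  define K' where "K' = {k \<otimes> x [^] i | k (i::nat). k \<in> K}"
  \<comment> \<open>Any representation of \<open>y\<close> may be chosen, because \<open>wd\<close>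
    makes the value independent of it.\<close>
  define f' where "f' y = (SOME c. \<exists>k\<in>K. \<exists>i::nat. y = k \<otimes> x [^] i \<and> c = f k * z ^ i)" for y
  have f': "f' (k \<otimes> x [^] i) = f k * z ^ i" if "k \<in> K" for k and i :: nat
  proof -
    have "\<exists>c. \<exists>k'\<in>K. \<exists>j::nat. k \<otimes> x [^] i = k' \<otimes> x [^] j \<and> c = f k' * z ^ j"
      using that by blast
    from someI_ex[OF this] obtain k' and j :: nat where "k' \<in> K" "k \<otimes> x [^] i = k' \<otimes> x [^] j"
      "f' (k \<otimes> x [^] i) = f k' * z ^ j" unfolding f'_def by blast
    with wd[OF that, of k' i j] show ?thesis by simp
  qed
  have mult: "(k \<otimes> x [^] i) \<otimes> (k' \<otimes> x [^] j) = (k \<otimes> k') \<otimes> x [^] (i + j)"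
    if "k \<in> K" "k' \<in> K" for k k' and i j :: nat
    using that x KG by (simp add: nat_pow_mult[symmetric] m_ac)
  have sub: "K \<subseteq> K'"
  proof
    fix k assume "k \<in> K"
    hence "k = k \<otimes> x [^] (0::nat)" using KG by simp
    thus "k \<in> K'" unfolding K'_def using \<open>k \<in> K\<close> by blast
  qed
  have xK': "x = \<one> \<otimes> x [^] (1::nat)" using x by simp
  have "subgroup K' G"
  proof
    show "K' \<subseteq> carrier G" unfolding K'_def using KG x by auto
    show "\<one> \<in> K'" using 1 sub by blast
    show "a \<otimes> b \<in> K'" if "a \<in> K'" "b \<in> K'" for a b
      using that mult Kclosed unfolding K'_def by blast
    show "inv a \<in> K'" if "a \<in> K'" for a
    proof -
      obtain k and i :: nat where a: "a = k \<otimes> x [^] i" "k \<in> K"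
        using \<open>a \<in> K'\<close> unfolding K'_def by blast
      have N: "order G > 0" using fin order_gt_0_iff_finite by blast
      \<comment> \<open>Elements of \<open>K'\<close> involve natural exponents only, so the inverse
        of \<open>x [^] i\<close> is written as a nonnegative power.\<close>
      have "x [^] i \<otimes> x [^] (i * (order G - 1)) = x [^] (i * order G)"
        using x N by (simp add: nat_pow_mult algebra_simps)
      also have "\<dots> = \<one>" using x by (metis mult.commute nat_pow_one nat_pow_pow pow_order_eq_1)
      finally have "inv (x [^] i) = x [^] (i * (order G - 1))"
        using x by (metis inv_equality m_comm nat_pow_closed)
      hence "inv a = inv k \<otimes> x [^] (i * (order G - 1))"
        using a x KG by (simp add: inv_mult)
      thus ?thesis unfolding K'_def using Kinv[OF a(2)] by blast
    qed
  qed
  moreover have "x \<in> K'" unfolding K'_def using xK' 1 by blast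
  moreover have "mult_character (G\<lparr>carrier := K'\<rparr>) f'"
  proof -
    have "f' \<one> = 1" using f'[OF 1, of 0] f1[OF 1 1] by simp
    moreover have "f' (a \<otimes> b) = f' a * f' b" if ab: "a \<in> K'" "b \<in> K'" for a b
    proof -
      obtain k k' and i j :: nat where "a = k \<otimes> x [^] i" "b = k' \<otimes> x [^] j" "k \<in> K" "k' \<in> K"
        using ab unfolding K'_def by blast
      thus ?thesis by (simp add: mult f' Kclosed fm power_add)
    qed
    ultimately show ?thesis by (simp add: mult_character_def)
  qed
  moreover have "\<forall>k\<in>K. f' k = f k" using f'[of _ 0] KG by simp
  moreover have "f' x = z" using f'[OF 1, of 1] f1[OF 1 1] x by simp
  ultimately show ?thesis using sub by blast
qed

lemma ex_least_power_in_subgroup: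
  assumes "finite (carrier G)" "subgroup K G" "x \<in> carrier G"
  obtains d :: nat where "0 < d" "x [^] d \<in> K" "\<And>i. 0 < i \<Longrightarrow> i < d \<Longrightarrow> x [^] i \<notin> K"
proof -
  let ?P = "\<lambda>d::nat. 0 < d \<and> x [^] d \<in> K"
  have "?P (order G)"
    using assms order_gt_0_iff_finite by (simp add: pow_order_eq_1 subgroup.one_closed)
  hence "?P (LEAST d. ?P d)" by (rule LeastI)
  moreover have "\<not> ?P i" if "i < (LEAST d. ?P d)" for i
    using that by (rule not_less_Least)
  ultimately show thesis using that[of "LEAST d. ?P d"] by blast
qed

text \<open>Begin with a character that is nontrivial at \<open>g\<close> on the cyclic subgroup of
  \<open>g\<close>, then extend it one element at a time. A largest subgroup carrying such a
  character must be the whole group.\<close>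

lemma separating_mult_character:
  assumes fin: "finite (carrier G)" and g: "g \<in> carrier G" "g \<noteq> \<one>"
  shows "\<exists>\<chi>. mult_character G \<chi> \<and> \<chi> g \<noteq> 1"
proof -
  define S where "S = {K. subgroup K G \<and> g \<in> K \<and>
    (\<exists>f. mult_character (G\<lparr>carrier := K\<rparr>) f \<and> f g \<noteq> 1)}"
  have triv: "subgroup {\<one>} G" by (rule triv_subgroup)
  obtain d :: nat where d: "0 < d" "g [^] d \<in> {\<one>}" "\<And>i. 0 < i \<Longrightarrow> i < d \<Longrightarrow> g [^] i \<notin> {\<one>}"
    using ex_least_power_in_subgroup[OF fin triv g(1)] by metis
  have "d \<noteq> 1" using d(2) g by auto
  hence "1 < d" using d by simp
  \<comment> \<open>A primitive \<open>d\<close>-th root of unity, where \<open>d\<close> is the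
    order of \<open>g\<close>; it differs from 1 because \<open>d > 1\<close>.\<close>
  define z where "z = cis (2 * pi / d)"
  have zd: "z ^ d = 1" using d(1) by (simp add: z_def DeMoivre)
  have "z \<noteq> 1"
  proof -
    have "bij_betw (\<lambda>k. cis (2 * pi * real k / real d)) {..<d} {z. z ^ d = 1}"
      using d(1) by (rule bij_betw_roots_unity)
    hence "cis (2 * pi * real 1 / real d) \<noteq> cis (2 * pi * real 0 / real d)"
      using \<open>1 < d\<close> unfolding bij_betw_def inj_on_def by (metis lessThan_iff less_trans zero_less_one zero_neq_one)
    thus ?thesis by (simp add: z_def)
  qed
  have "mult_character (G\<lparr>carrier := {\<one>}\<rparr>) (\<lambda>_. 1)" by (simp add: mult_character_def)
  from mult_character_extend[OF fin triv this g(1) d, of z] zd \<open>z \<noteq> 1\<close>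
  have "S \<noteq> {}" unfolding S_def by fastforce
  have bound: "card K \<le> card (carrier G)" if "K \<in> S" for K
    using that fin by (intro card_mono) (auto simp: S_def dest: subgroup.subset)
  obtain K where K: "K \<in> S" "\<And>L. L \<in> S \<Longrightarrow> card L \<le> card K"
    using \<open>S \<noteq> {}\<close> bound
    by (metis ex_has_greatest_nat[of "\<lambda>K. K \<in> S" _ card "Suc (card (carrier G))"] ex_in_conv le_imp_less_Suc)
  then obtain f where f: "subgroup K G" "g \<in> K" "mult_character (G\<lparr>carrier := K\<rparr>) f" "f g \<noteq> 1"
    unfolding S_def by blast
  have sub: "K \<subseteq> carrier G" using f(1) by (rule subgroup.subset)
  have "K = carrier G"
  proof (rule ccontr)
    assume "K \<noteq> carrier G"
    then obtain x where x: "x \<in> carrier G" "x \<notin> K" using sub by blast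
    obtain e :: nat where e: "0 < e" "x [^] e \<in> K" "\<And>i. 0 < i \<Longrightarrow> i < e \<Longrightarrow> x [^] i \<notin> K"
      using ex_least_power_in_subgroup[OF fin f(1) x(1)] by metis
    \<comment> \<open>Being nonzero, this value has an \<open>e\<close>-th root, which can serve as
      the value of the extension at \<open>x\<close>.\<close>
    have "f (x [^] e) \<noteq> 0"
      using f(1,3) e(2) subgroup.subgroup_is_group[OF f(1) group_axioms]
        group.mult_character_inv[of "G\<lparr>carrier := K\<rparr>" f "x [^] e"] by auto
    then obtain y where "y ^ e = f (x [^] e)"
      using e(1) card_nth_roots[of "f (x [^] e)" e]
      by (metis (mono_tags, lifting) card.empty empty_Collect_eq less_irrefl)
    from mult_character_extend[OF fin f(1,3) x(1) e this]
    obtain K' f' where K': "subgroup K' G" "K \<subseteq> K'" "x \<in> K'"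
      "mult_character (G\<lparr>carrier := K'\<rparr>) f'" "\<forall>k\<in>K. f' k = f k" by blast
    hence "K' \<in> S" unfolding S_def using f by fastforce
    hence "card K' \<le> card K" by (rule K(2))
    moreover have "K \<subset> K'" using K' x by blast
    hence "card K < card K'"
      using K'(1) fin by (intro psubset_card_mono) (auto dest: subgroup.subset finite_subset)
    ultimately show False by simp
  qed
  thus ?thesis using f(3,4) by auto
qed

section \<open>The finite set of characters and its orthogonality relations\<close>

lemma principal_character_in: "principal_character G \<in> characters G"
  by (simp add: characters_def mult_character_def principal_character_def)

lemma characters_eqI:
  assumes "\<chi> \<in> characters G" "\<theta> \<in> characters G" "\<And>x. x \<in> carrier G \<Longrightarrow> \<chi> x = \<theta> x"
  shows "\<chi> = \<theta>"
  using assms by (auto simp: characters_def intro: extensionalityI)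

lemma non_principal_character:
  assumes "\<chi> \<in> characters G" "\<chi> \<noteq> principal_character G"
  obtains a where "a \<in> carrier G" "\<chi> a \<noteq> 1"
  using characters_eqI[OF assms(1) principal_character_in] assms(2)
  by (auto simp: principal_character_def)

lemma finite_characters:
  assumes "finite (carrier G)"
  shows "finite (characters G)"
proof (rule finite_subset)
  show "characters G \<subseteq> (\<Pi>\<^sub>E x\<in>carrier G. {z. z ^ order G = 1})"
    by (auto simp: characters_def PiE_def mult_character_power_order)
  show "finite (\<Pi>\<^sub>E x\<in>carrier G. {z::complex. z ^ order G = 1})"
    using assms order_gt_0_iff_finite by (intro finite_PiE finite_nth_roots) auto
qed

text \<open>Multiplication by a character \<theta> with \<open>\<theta> g \<noteq> 1\<close>
  permutes the characters, with inverse given by \<theta> composed with inversion, and scales the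
  sum by \<open>\<theta> g\<close>.\<close>

lemma sum_characters_eq_0:
  assumes "finite (carrier G)" "g \<in> carrier G" "g \<noteq> \<one>"
  shows "(\<Sum>\<chi>\<in>characters G. \<chi> g) = 0"
proof -
  obtain \<theta> where \<theta>: "mult_character G \<theta>" "\<theta> g \<noteq> 1"
    using separating_mult_character[OF assms] by blast
  let ?m = "\<lambda>\<theta> \<chi>. restrict (\<lambda>x. \<theta> x * \<chi> x) (carrier G)"
  have in_chars: "?m \<theta> \<chi> \<in> characters G" if "mult_character G \<theta>" "\<chi> \<in> characters G" for \<theta> \<chi>
    using that by (auto simp: characters_def mult_character_def)
  have inv: "mult_character G (\<lambda>x. \<theta> (inv x))"
    using \<theta>(1) by (simp add: mult_character_def inv_mult)
  have cancel: "\<theta> x * \<theta> (inv x) = 1" "\<theta> (inv x) * \<theta> x = 1" if "x \<in> carrier G" for x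
    using mult_character_inv[OF \<theta>(1) that] by (simp_all add: mult.commute)
  have "bij_betw (?m \<theta>) (characters G) (characters G)"
  proof (rule bij_betw_byWitness[where f' = "?m (\<lambda>x. \<theta> (inv x))"])
    show "\<forall>\<chi>\<in>characters G. ?m (\<lambda>x. \<theta> (inv x)) (?m \<theta> \<chi>) = \<chi>"
      using in_chars[OF inv in_chars[OF \<theta>(1)]] cancel
      by (auto intro!: characters_eqI simp del: restrict_apply simp: restrict_apply' mult.assoc[symmetric])
    show "\<forall>\<chi>\<in>characters G. ?m \<theta> (?m (\<lambda>x. \<theta> (inv x)) \<chi>) = \<chi>"
      using in_chars[OF \<theta>(1) in_chars[OF inv]] cancel
      by (auto intro!: characters_eqI simp del: restrict_apply simp: restrict_apply' mult.assoc[symmetric])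
  qed (use in_chars inv \<theta> in auto)
  hence "(\<Sum>\<chi>\<in>characters G. \<chi> g) = (\<Sum>\<chi>\<in>characters G. ?m \<theta> \<chi> g)"
    by (rule sum.reindex_bij_betw[symmetric])
  also have "\<dots> = \<theta> g * (\<Sum>\<chi>\<in>characters G. \<chi> g)"
    using assms(2) by (simp add: sum_distrib_left)
  finally show ?thesis using \<theta>(2) by (simp add: algebra_simps)
qed

text \<open>Sum \<open>\<chi> g\<close> over all pairs in both orders. Summing over characters first
  leaves only the identity; summing over elements first leaves only the principal character.\<close>

lemma card_characters:
  assumes "finite (carrier G)"
  shows "card (characters G) = order G"
proof -
  have one: "\<chi> \<one> = 1" if "\<chi> \<in> characters G" for \<chi>
    using that by (simp add: characters_def mult_character_def)
  have "of_nat (card (characters G)) = (\<Sum>g\<in>carrier G. \<Sum>\<chi>\<in>characters G. \<chi> g)"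
  proof -
    have "(\<Sum>g\<in>carrier G. \<Sum>\<chi>\<in>characters G. \<chi> g) =
        (\<Sum>g\<in>carrier G. if g = \<one> then of_nat (card (characters G)) else 0)"
      using sum_characters_eq_0[OF assms] sum.cong[OF refl one, of "characters G"]
      by (intro sum.cong refl) auto
    thus ?thesis using assms by simp
  qed
  also have "\<dots> = (\<Sum>\<chi>\<in>characters G. \<Sum>g\<in>carrier G. \<chi> g)"
    by (rule sum.swap)
  also have "\<dots> = (\<Sum>\<chi>\<in>characters G. if \<chi> = principal_character G then of_nat (order G) else 0)"
  proof (intro sum.cong refl)
    fix \<chi> assume \<chi>: "\<chi> \<in> characters G"
    show "sum \<chi> (carrier G) = (if \<chi> = principal_character G then of_nat (order G) else 0)"
    proof (cases "\<chi> = principal_character G")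
      case True
      thus ?thesis by (simp add: principal_character_def order_def)
    next
      case False
      with \<chi> obtain a where "a \<in> carrier G" "\<chi> a \<noteq> 1" by (rule non_principal_character)
      with \<chi> False show ?thesis by (simp add: characters_def sum_mult_character_eq_0)
    qed
  qed
  also have "\<dots> = of_nat (order G)"
    using finite_characters[OF assms] principal_character_in by simp
  finally show ?thesis by (simp only: of_nat_eq_iff)
qed

lemma sum_characters:
  assumes "finite (carrier G)" "g \<in> carrier G"
  shows "(\<Sum>\<chi>\<in>characters G. \<chi> g) = (if g = \<one> then of_nat (order G) else 0)"
  using sum_characters_eq_0[OF assms] card_characters[OF assms(1)]
  by (simp add: characters_def mult_character_def)

end

subsection \<open>Character values and multipliers of partial difference sets\<close>

text \<open>By Bezout, the exponent 1 is a combination of \<open>a\<close> and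
  \<open>b\<close>.\<close>

lemma coprime_roots_of_unity:
  fixes z :: complex
  assumes "coprime a b" "z ^ a = 1" "z ^ b = 1"
  shows "z = 1"
proof (cases "a = 0")
  case True
  thus ?thesis using assms by simp
next
  case False
  then obtain x y where "a * x = b * y + 1"
    using bezout_nat[of a b] assms(1) by (auto simp: coprime_iff_gcd_eq_1)
  hence "(z ^ a) ^ x = (z ^ b) ^ y * z" by (simp flip: power_mult power_Suc2)
  thus ?thesis using assms by simp
qed

context comm_group
begin

text \<open>In the group ring, D times its inverse set equals k + lam D + mu (G - 1 - D). Apply
  \<chi>: inversion preserves \<open>D\<close>, and the sum over \<open>G\<close> vanishes.\<close>

lemma regular_pds_character_sum:
  assumes fin: "finite (carrier G)" and pds: "regular_pds G D v k lam mu"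
    and \<chi>: "mult_character G \<chi>" and a: "a \<in> carrier G" "\<chi> a \<noteq> 1"
  shows "(sum \<chi> D)\<^sup>2 = of_int (k - mu) + of_int (lam - mu) * sum \<chi> D"
proof -
  define pairs where "pairs x = {(g, h) \<in> D \<times> D. g \<otimes> inv h = x}" for x
  have D: "D \<subseteq> carrier G" "\<one> \<notin> D" "int (card D) = k" "\<And>x. x \<in> D \<Longrightarrow> inv x \<in> D"
    and count: "\<And>x. x \<in> carrier G - {\<one>} \<Longrightarrow>
      int (card {(g, h). g \<in> D \<and> h \<in> D \<and> g \<noteq> h \<and> g \<otimes> inv h = x}) = (if x \<in> D then lam else mu)"
    using pds by (auto simp: regular_pds_def pds_def)
  have finD: "finite D" using D(1) fin by (rule finite_subset)
  have pairs1: "int (card (pairs \<one>)) = k"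
  proof -
    have "pairs \<one> = (\<lambda>g. (g, g)) ` D"
    proof -
      have "g = h" if "g \<in> D" "h \<in> D" "g \<otimes> inv h = \<one>" for g h
        using that D(1) by (metis inv_closed inv_equality inv_inv subsetD)
      thus ?thesis unfolding pairs_def using D(1) by (auto simp: subset_iff)
    qed
    thus ?thesis using D(3) by (simp add: card_image inj_on_def)
  qed
  have pairs: "int (card (pairs x)) = (if x \<in> D then lam else mu)" if "x \<in> carrier G - {\<one>}" for x
  proof -
    have "pairs x = {(g, h). g \<in> D \<and> h \<in> D \<and> g \<noteq> h \<and> g \<otimes> inv h = x}"
      using that D(1) by (auto simp: pairs_def subset_iff)
    thus ?thesis using count[OF that] by simp
  qed
  have inv: "sum \<chi> D = (\<Sum>h\<in>D. \<chi> (inv h))"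
  proof (rule sum.reindex_bij_betw[symmetric, where h = "m_inv G"])
    show "bij_betw (m_inv G) D D"
      by (rule bij_betw_byWitness[where f' = "m_inv G"]) (use D in \<open>auto simp: subset_iff\<close>)
  qed
  have "(sum \<chi> D)\<^sup>2 = sum \<chi> D * (\<Sum>h\<in>D. \<chi> (inv h))"
    by (simp add: power2_eq_square flip: inv)
  also have "\<dots> = (\<Sum>(g, h)\<in>D \<times> D. \<chi> (g \<otimes> inv h))"
  proof -
    have "\<chi> g * \<chi> (inv h) = \<chi> (g \<otimes> inv h)" if "g \<in> D" "h \<in> D" for g h
      using that \<chi> D(1) by (auto simp: mult_character_def subset_iff)
    thus ?thesis by (simp add: sum_product sum.cartesian_product)
  qed
  also have "\<dots> = (\<Sum>x\<in>carrier G. \<Sum>(g, h)\<in>pairs x. \<chi> (g \<otimes> inv h))"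
  proof -
    have "(\<Sum>x\<in>carrier G. \<Sum>p\<in>{p \<in> D \<times> D. (\<lambda>(g, h). g \<otimes> inv h) p = x}. (\<lambda>(g, h). \<chi> (g \<otimes> inv h)) p) =
        (\<Sum>(g, h)\<in>D \<times> D. \<chi> (g \<otimes> inv h))"
      using finD fin D(1) by (intro sum.group) (auto simp: subset_iff)
    moreover have "{p \<in> D \<times> D. (\<lambda>(g, h). g \<otimes> inv h) p = x} = pairs x" for x
      by (auto simp: pairs_def)
    ultimately show ?thesis by simp
  qed
  also have "\<dots> = (\<Sum>x\<in>carrier G. of_int (int (card (pairs x))) * \<chi> x)"
  proof (intro sum.cong refl)
    fix x
    have "(\<Sum>(g, h)\<in>pairs x. \<chi> (g \<otimes> inv h)) = (\<Sum>p\<in>pairs x. \<chi> x)"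
      by (intro sum.cong) (auto simp: pairs_def)
    thus "(\<Sum>(g, h)\<in>pairs x. \<chi> (g \<otimes> inv h)) = of_int (int (card (pairs x))) * \<chi> x" by simp
  qed
  also have "\<dots> = of_int k * \<chi> \<one> +
      (\<Sum>x\<in>carrier G - {\<one>}. of_int (int (card (pairs x))) * \<chi> x)"
    using fin by (simp add: sum.remove[of _ \<one>] pairs1[symmetric])
  \<comment> \<open>The count is \<open>mu\<close> everywhere off the identity, with a correction
    \<open>lam - mu\<close> on \<open>D\<close>.\<close>
  also have "(\<Sum>x\<in>carrier G - {\<one>}. of_int (int (card (pairs x))) * \<chi> x) =
      (\<Sum>x\<in>carrier G - {\<one>}. of_int mu * \<chi> x + (if x \<in> D then of_int (lam - mu) * \<chi> x else 0))"
    using pairs by (intro sum.cong refl) (auto simp: algebra_simps simp del: of_int_of_nat_eq)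
  also have "\<dots> = of_int mu * (\<Sum>x\<in>carrier G - {\<one>}. \<chi> x) + of_int (lam - mu) * sum \<chi> D"
  proof -
    have "(carrier G - {\<one>}) \<inter> D = D" using D by auto
    thus ?thesis using fin by (simp add: sum.distrib sum_distrib_left flip: sum.inter_restrict)
  qed
  also have "(\<Sum>x\<in>carrier G - {\<one>}. \<chi> x) = - \<chi> \<one>"
    using sum_mult_character_eq_0[OF \<chi> a] fin by (simp add: sum.remove[of _ \<one>] eq_neg_iff_add_eq_0 add.commute)
  finally show ?thesis
    using \<chi> by (simp add: mult_character_def algebra_simps)
qed

text \<open>For these parameters the quadratic equation of the character value X factors as (X -
  r)(X - (r - n)) = 0.\<close>

lemma nls_pds_character_sum:
  assumes "finite (carrier G)" "nls_pds G D n r" "mult_character G \<chi>" "a \<in> carrier G" "\<chi> a \<noteq> 1"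
  shows "sum \<chi> D = of_int r \<or> sum \<chi> D = of_int (r - n)"
proof -
  have "(sum \<chi> D)\<^sup>2 = of_int (r * (n + 1) - (r\<^sup>2 + r)) +
      of_int (- n + r\<^sup>2 + 3 * r - (r\<^sup>2 + r)) * sum \<chi> D"
    using assms by (intro regular_pds_character_sum) (auto simp: nls_pds_def)
  hence "(sum \<chi> D - of_int r) * (sum \<chi> D - of_int (r - n)) = 0"
    by (simp add: algebra_simps power2_eq_square)
  thus ?thesis by simp
qed

text \<open>Modulo \<open>p\<close>, the value of \<open>\<chi>\<^sup>p\<close> on \<open>D\<close> is the \<open>p\<close>-th power of the value of \<open>\<chi>\<close>, hence by Fermat
  congruent to the latter; both are \<open>r\<close> or \<open>r - n\<close>, and \<open>p\<close> does not divide \<open>n\<close>.\<close>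

lemma nls_pds_prime_multiplier:
  assumes fin: "finite (carrier G)" and pds: "nls_pds G D n r"
    and \<chi>: "mult_character G \<chi>" and a: "a \<in> carrier G" "\<chi> a \<noteq> 1"
    and p: "Factorial_Ring.prime p" "\<not> p dvd order G"
  shows "(\<Sum>g\<in>D. \<chi> g ^ p) = sum \<chi> D"
proof -
  let ?R = "cyclotomic_integers (order G)"
  have N: "order G > 0" using fin order_gt_0_iff_finite by blast
  have D: "D \<subseteq> carrier G" and n: "int (order G) = n\<^sup>2"
    using pds by (auto simp: nls_pds_def regular_pds_def pds_def order_def)
  have \<chi>p: "mult_character G (\<lambda>g. \<chi> g ^ p)"
    using \<chi> by (simp add: mult_character_def power_mult_distrib)
  have "coprime p (order G)" using p by (simp add: prime_imp_coprime)
  \<comment> \<open>The power \<chi>^p stays nontrivial because \<open>p\<close> is coprime to the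
    group order, so its value is again one of the two.\<close>
  hence ap: "\<chi> a ^ p \<noteq> 1"
    using coprime_roots_of_unity[of p "order G" "\<chi> a"] a mult_character_power_order[OF \<chi>] by blast
  obtain s where s: "sum \<chi> D = of_int s" "s = r \<or> s = r - n"
    using nls_pds_character_sum[OF fin pds \<chi> a] by metis
  obtain t where t: "(\<Sum>g\<in>D. \<chi> g ^ p) = of_int t" "t = r \<or> t = r - n"
    using nls_pds_character_sum[OF fin pds \<chi>p a(1) ap] by metis
  obtain c where c: "c \<in> ?R" "sum \<chi> D ^ p = (\<Sum>g\<in>D. \<chi> g ^ p) + of_nat p * c"
    using cyclotomic_integers_frobenius_sum[OF p(1), of D \<chi> "order G"] D fin
      mult_character_power_order[OF \<chi>]
    by (meson cyclotomic_integers.root finite_subset subsetD)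
  have p0: "p > 0" using p(1) by (simp add: prime_gt_0_nat)
  \<comment> \<open>The error term \<open>c\<close> is thus a rational cyclotomic integer, which
    turns the congruence into one between integers.\<close>
  have "of_rat (of_int (s ^ p - t) / of_nat p) = c"
    using c(2) p0 by (simp add: s(1) t(1) of_rat_divide of_rat_diff of_rat_power field_simps)
  hence "of_int (s ^ p - t) / of_nat p \<in> (\<int> :: rat set)"
    using rational_cyclotomic_integer_Ints[OF N] c(1) by metis
  then obtain m where "of_int (s ^ p - t) / of_nat p = (of_int m :: rat)"
    by (auto elim: Ints_cases)
  hence "(of_int (s ^ p - t) :: rat) = of_int (int p * m)"
    using p0 by (simp add: field_simps)
  hence "int p dvd s ^ p - t" by (simp only: of_int_eq_iff) simp
  with prime_dvd_int_power_diff[OF p(1), of s] have "int p dvd s - t"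
    using dvd_diff[of "int p" "s ^ p - t" "s ^ p - s"] by simp
  moreover have "\<not> int p dvd n"
  proof
    assume "int p dvd n"
    hence "int p dvd int (order G)" using n by (simp add: power2_eq_square)
    thus False using p(2) by simp
  qed
  \<comment> \<open>The difference \<open>s - t\<close> is 0, \<open>n\<close> or \<open>-n\<close>,
    and \<open>p\<close> divides it but not \<open>n\<close>.\<close>
  ultimately have "s = t" using s(2) t(2) by (auto simp: dvd_minus_iff[of _ n, symmetric] simp del: dvd_minus_iff)
  thus ?thesis using s t by simp
qed

text \<open>Split off one prime factor of \<open>s\<close> at a time. The character must vary in the
  induction, since the remaining factor acts on \<chi>^p.\<close>

lemma nls_pds_multiplier:
  assumes fin: "finite (carrier G)" and pds: "nls_pds G D n r"
    and "mult_character G \<chi>" and a: "a \<in> carrier G" and "\<chi> a \<noteq> 1"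
    and "0 < s" and "coprime s (order G)"
  shows "(\<Sum>g\<in>D. \<chi> g ^ s) = sum \<chi> D"
  using assms(3,5-7)
proof (induction s arbitrary: \<chi> rule: less_induct)
  case (less s)
  show ?case
  proof (cases "s = 1")
    case False
    then obtain p where p: "Factorial_Ring.prime p" "p dvd s" using prime_factor_nat by blast
    then obtain t where t: "s = p * t" by blast
    have cop: "coprime p (order G)" "coprime t (order G)" using less.prems(4) t by auto
    hence np: "\<not> p dvd order G" using p(1) coprime_absorb_left not_prime_unit by blast
    have \<chi>p: "mult_character G (\<lambda>g. \<chi> g ^ p)"
      using less.prems(1) by (simp add: mult_character_def power_mult_distrib)
    have ap: "\<chi> a ^ p \<noteq> 1"
      using coprime_roots_of_unity[OF cop(1), of "\<chi> a"] a less.prems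
        mult_character_power_order[OF less.prems(1)] by blast
    have "t < s" "0 < t" using t less.prems(3) prime_gt_1_nat[OF p(1)] by auto
    hence "(\<Sum>g\<in>D. (\<chi> g ^ p) ^ t) = (\<Sum>g\<in>D. \<chi> g ^ p)"
      using less.IH[of t "\<lambda>g. \<chi> g ^ p"] \<chi>p ap cop(2) by simp
    also have "\<dots> = sum \<chi> D"
      using nls_pds_prime_multiplier[OF fin pds less.prems(1) a less.prems(2) p(1) np] .
    finally show ?thesis by (simp add: t power_mult)
  qed simp
qed

end

subsection \<open>Groups of order nine times a square\<close>

context comm_group
begin

lemma pow_cong:
  fixes i j m :: nat
  assumes "x \<in> carrier G" "x [^] m = \<one>" "[i = j] (mod m)"
  shows "x [^] i = x [^] j"
proof -
  have red: "x [^] k = x [^] (k mod m)" for k :: nat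
  proof -
    have "x [^] k = (x [^] m) [^] (k div m) \<otimes> x [^] (k mod m)"
      using assms(1) by (simp add: nat_pow_pow nat_pow_mult)
    thus ?thesis using assms(1,2) by simp
  qed
  show ?thesis using red[of i] red[of j] assms(3) by (simp add: cong_def)
qed

lemma torsion_subgroup: "subgroup {x \<in> carrier G. x [^] (m::nat) = \<one>} G"
proof
  show "inv x \<in> {x \<in> carrier G. x [^] m = \<one>}" if "x \<in> {x \<in> carrier G. x [^] m = \<one>}" for x
    using that by (simp add: nat_pow_inv)
qed (auto simp: nat_pow_distrib)

lemma subgroup_comm_group:
  assumes "subgroup H G"
  shows "comm_group (G\<lparr>carrier := H\<rparr>)"
proof -
  interpret H: group "G\<lparr>carrier := H\<rparr>"
    using assms group_axioms by (rule subgroup.subgroup_is_group)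
  show ?thesis
    by (rule H.group_comm_groupI) (use assms in \<open>simp add: m_comm subgroup.mem_carrier\<close>)
qed

text \<open>A Sylow subgroup of order \<open>p ^ k\<close> turns out to be the first torsion
  subgroup; the second is then counted through the direct product decomposition of
  \<open>G\<close>.\<close>

lemma card_torsion_subgroups:
  assumes p: "Factorial_Ring.prime p" and N: "order G = p ^ k * b" "0 < b" and cop: "coprime p b"
  shows "card {x \<in> carrier G. x [^] (p ^ k) = \<one>} = p ^ k"
    and "card {x \<in> carrier G. x [^] b = \<one>} = b"
proof -
  let ?a = "p ^ k"
  let ?P = "{x \<in> carrier G. x [^] ?a = \<one>}" and ?Q = "{x \<in> carrier G. x [^] b = \<one>}"
  have a0: "?a > 0" using p by (simp add: prime_gt_0_nat)
  hence fin: "finite (carrier G)" using N order_gt_0_iff_finite by (metis nat_0_less_mult_iff)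
  have cop': "coprime ?a b" using cop by simp
  \<comment> \<open>The exponents \<open>u\<close> and \<open>v\<close> act as complementary
    idempotents: \<open>g [^] u\<close> and \<open>g [^] v\<close> are the two components of
    \<open>g\<close>.\<close>
  obtain u where u: "[u = 1] (mod ?a)" "[u = 0] (mod b)"
    using binary_chinese_remainder_nat[OF cop'] by blast
  obtain v where v: "[v = 0] (mod ?a)" "[v = 1] (mod b)"
    using binary_chinese_remainder_nat[OF cop'] by blast
  have "[u + v = 1] (mod ?a)" "[u + v = 1] (mod b)"
    using cong_add[OF u(1) v(1)] cong_add[OF u(2) v(2)] by simp_all
  hence "[u + v = 1] (mod ?a * b)" using cop' by (rule coprime_cong_mult_nat)
  hence uv: "g [^] (u + v) = g" if "g \<in> carrier G" for g
    using pow_cong[OF that pow_order_eq_1[OF that], of "u + v" 1] that N by simp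
  obtain H where H: "subgroup H G" "card H = ?a"
    using sylow_thm[OF _ group_axioms _ fin] p N by blast
  interpret H: normal H G using H(1) by (rule subgroup_imp_normal)
  interpret M: group "G Mod H" by (rule H.factorgroup_is_group)
  have "order (G Mod H) * card H = order G"
    using lagrange[OF H(1)] by (simp add: order_def FactGroup_def)
  hence oM: "order (G Mod H) = b" using H(2) N(1) prime_gt_0_nat[OF p] by simp
  have HP: "H = ?P"
  proof
    interpret K: group "G\<lparr>carrier := H\<rparr>"
      using H(1) group_axioms by (rule subgroup.subgroup_is_group)
    show "H \<subseteq> ?P"
    proof
      fix h assume "h \<in> H"
      thus "h \<in> ?P"
        using K.pow_order_eq_1[of h] H by (simp add: order_def flip: nat_pow_consistent)
    qed
    \<comment> \<open>The quotient by \<open>H\<close> has order \<open>b\<close>, so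
      \<open>g [^] b\<close> lies in \<open>H\<close>; for \<open>g\<close> in \<open>?P\<close> one
      has \<open>g = g [^] u\<close> with \<open>b\<close> dividing \<open>u\<close>.\<close>
    show "?P \<subseteq> H"
    proof
      fix g assume g: "g \<in> ?P"
      hence gG: "g \<in> carrier G" by simp
      have "H #> g \<in> carrier (G Mod H)" using gG by (auto simp: carrier_FactGroup)
      hence "(H #> g) [^]\<^bsub>G Mod H\<^esub> b = \<one>\<^bsub>G Mod H\<^esub>"
        using M.pow_order_eq_1 oM by metis
      hence "H #> (g [^] b) = H" using H.FactGroup_pow[OF gG] by simp
      hence "g [^] b \<in> H" using gG using rcos_self[OF _ H(1)] by (metis nat_pow_closed)
      hence gb: "(g [^] b) [^] j \<in> H" for j :: nat
        by (induction j) auto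
      have "g [^] u = g [^] (1::nat)" using g u by (intro pow_cong[of g ?a]) auto
      moreover obtain j where "u = b * j" using u(2) by (auto simp: cong_0_iff)
      ultimately show "g \<in> H" using gb[of j] gG by (simp add: nat_pow_pow)
    qed
  qed
  show cP: "card ?P = ?a" using H(2) unfolding HP .
  have "bij_betw (\<lambda>(x, y). x \<otimes> y) (?P \<times> ?Q) (carrier G)"
  proof (rule bij_betw_byWitness[where f' = "\<lambda>g. (g [^] u, g [^] v)"])
    have xu: "x [^] u = x" "x [^] v = \<one>" if "x \<in> ?P" for x
    proof -
      have "x [^] u = x [^] (1::nat)" "x [^] v = x [^] (0::nat)"
        using that u v by (intro pow_cong[of x ?a]; simp)+
      thus "x [^] u = x" "x [^] v = \<one>" using that by simp_all
    qed
    have yv: "y [^] u = \<one>" "y [^] v = y" if "y \<in> ?Q" for y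
    proof -
      have "y [^] u = y [^] (0::nat)" "y [^] v = y [^] (1::nat)"
        using that u v by (intro pow_cong[of y b]; simp)+
      thus "y [^] u = \<one>" "y [^] v = y" using that by simp_all
    qed
    show "\<forall>z\<in>?P \<times> ?Q. (\<lambda>g. (g [^] u, g [^] v)) ((\<lambda>(x, y). x \<otimes> y) z) = z"
      by (auto simp: nat_pow_distrib xu[simplified] yv[simplified])
    show "\<forall>g\<in>carrier G. (\<lambda>(x, y). x \<otimes> y) (g [^] u, g [^] v) = g"
      using uv by (auto simp: nat_pow_mult)
    show "(\<lambda>g. (g [^] u, g [^] v)) ` carrier G \<subseteq> ?P \<times> ?Q"
    proof (rule image_subsetI)
      fix g assume g: "g \<in> carrier G"
      obtain i j where "u = b * i" "v = ?a * j" using u(2) v(1) by (metis cong_0_iff dvdE)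
      hence "u * ?a = order G * i" "v * b = order G * j" by (simp_all add: N)
      hence "g [^] (u * ?a) = (g [^] order G) [^] i" "g [^] (v * b) = (g [^] order G) [^] j"
        using g by (simp_all only: nat_pow_pow)
      hence "g [^] (u * ?a) = \<one>" "g [^] (v * b) = \<one>"
        using pow_order_eq_1[OF g] by simp_all
      thus "(g [^] u, g [^] v) \<in> ?P \<times> ?Q"
        using g by (simp add: nat_pow_pow)
    qed
  qed auto
  hence "card (?P \<times> ?Q) = order G" by (simp add: bij_betw_same_card order_def)
  thus "card ?Q = b" using cP N(1) prime_gt_0_nat[OF p] by (simp add: card_cartesian_product)
qed

end

lemma root_of_unity_power_cong:
  fixes z :: complex
  assumes "z ^ m = 1" "[i = j] (mod m)"
  shows "z ^ i = z ^ j"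
proof -
  have "z ^ k = z ^ (k mod m)" for k
    using assms(1) by (metis mod_mult_div_eq mult_1_right power_add power_mult power_one)
  thus ?thesis using assms(2) by (metis cong_def)
qed

context comm_group
begin

lemma nls_pds_order_9_square:
  fixes w r :: nat
  assumes N: "order G = 9 * w\<^sup>2" and w0: "0 < w" and cop: "coprime 3 w" and r: "1 \<le> r"
    and pds: "nls_pds G D (3 * int w) (int r)"
  shows "3 * w \<le> 2 * r + 3"
proof -

  \<comment> \<open>Splitting of the group into its 9-torsion and its
    \<open>w\<^sup>2\<close>-torsion\<close>
  have fin: "finite (carrier G)" using N w0 order_gt_0_iff_finite by simp
  define P where "P = {x \<in> carrier G. x [^] (9::nat) = \<one>}"
  define Q where "Q = {x \<in> carrier G. x [^] (w\<^sup>2) = \<one>}"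
  define GP where "GP = G\<lparr>carrier := P\<rparr>"
  define GQ where "GQ = G\<lparr>carrier := Q\<rparr>"
  have sub: "subgroup P G" "subgroup Q G" unfolding P_def Q_def by (rule torsion_subgroup)+
  interpret P: comm_group GP unfolding GP_def using sub(1) by (rule subgroup_comm_group)
  interpret Q: comm_group GQ unfolding GQ_def using sub(2) by (rule subgroup_comm_group)
  have [simp]: "carrier GP = P" "\<one>\<^bsub>GP\<^esub> = \<one>" "carrier GQ = Q" "\<one>\<^bsub>GQ\<^esub> = \<one>"
    "x \<otimes>\<^bsub>GP\<^esub> y = x \<otimes> y" "x \<otimes>\<^bsub>GQ\<^esub> y = x \<otimes> y" for x y
    by (simp_all add: GP_def GQ_def)
  have finP: "finite (carrier GP)" and finQ: "finite (carrier GQ)"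
    using fin by (simp_all add: P_def Q_def)
  have "card P = 9" "card Q = w\<^sup>2"
    using card_torsion_subgroups[of 3 2 "w\<^sup>2"] N w0 cop by (simp_all add: P_def Q_def)
  hence oP: "order GP = 9" and oQ: "order GQ = w\<^sup>2"
    by (simp_all add: order_def)
  have c9: "coprime (9::nat) (w\<^sup>2)" using cop coprime_power_left_iff[of 3 2 "w\<^sup>2"] by simp
  obtain u where u: "[u = 1] (mod 9)" "[u = 0] (mod w\<^sup>2)"
    using binary_chinese_remainder_nat[OF c9] by blast
  obtain v where v: "[v = 0] (mod 9)" "[v = 1] (mod w\<^sup>2)"
    using binary_chinese_remainder_nat[OF c9] by blast
  have "[u + v = 1] (mod 9)" "[u + v = 1] (mod w\<^sup>2)"
    using cong_add[OF u(1) v(1)] cong_add[OF u(2) v(2)] by simp_all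
  hence "[u + v = 1] (mod 9 * w\<^sup>2)" using c9 by (rule coprime_cong_mult_nat)
  hence uv: "g [^] u \<otimes> g [^] v = g" if "g \<in> carrier G" for g
    using pow_cong[OF that pow_order_eq_1[OF that], of "u + v" 1] that N by (simp add: nat_pow_mult)
  have proj: "g [^] u \<in> P" "g [^] v \<in> Q" if "g \<in> carrier G" for g
  proof -
    have "[u * 9 = 0] (mod 9 * w\<^sup>2)" "[v * w\<^sup>2 = 0] (mod 9 * w\<^sup>2)"
      using u(2) v(1) by (auto simp: cong_0_iff mult.commute)
    hence "g [^] (u * 9) = g [^] (0::nat)" "g [^] (v * w\<^sup>2) = g [^] (0::nat)"
      using pow_cong[OF that pow_order_eq_1[OF that]] N by metis+
    thus "g [^] u \<in> P" "g [^] v \<in> Q"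
      using that by (simp_all add: P_def Q_def nat_pow_pow)
  qed
  have Pu: "x [^] u = x" "x [^] v = \<one>" if "x \<in> P" for x
    using that pow_cong[of x 9 u 1] pow_cong[of x 9 v 0] u v by (auto simp: P_def)
  have Qv: "x [^] u = \<one>" "x [^] v = x" if "x \<in> Q" for x
    using that pow_cong[of x "w\<^sup>2" u 0] pow_cong[of x "w\<^sup>2" v 1] u v by (auto simp: Q_def)

  have D: "D \<subseteq> carrier G" "\<one> \<notin> D" "card D = r * (3 * w + 1)" "\<And>x. x \<in> D \<Longrightarrow> inv x \<in> D"
  proof -
    have "int (card D) = int (r * (3 * w + 1))"
      using pds by (simp add: nls_pds_def regular_pds_def pds_def algebra_simps)
    thus "card D = r * (3 * w + 1)" by (simp only: of_nat_eq_iff)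
  qed (use pds in \<open>auto simp: nls_pds_def regular_pds_def pds_def\<close>)
  have finD: "finite D" using D(1) fin by (rule finite_subset)
  have DG: "g \<in> carrier G" if "g \<in> D" for g using that D(1) by blast

  \<comment> \<open>Characters of the two factors and their values on \<open>D\<close>\<close>
  let ?PC = "characters GP" and ?QC = "characters GQ"
  define \<psi>\<^sub>0 where "\<psi>\<^sub>0 = principal_character GP"
  define \<eta>\<^sub>0 where "\<eta>\<^sub>0 = principal_character GQ"
  have \<psi>0: "\<psi>\<^sub>0 \<in> ?PC" "\<And>x. x \<in> P \<Longrightarrow> \<psi>\<^sub>0 x = 1"
    using P.principal_character_in by (simp_all add: \<psi>\<^sub>0_def principal_character_def)
  have \<eta>0: "\<eta>\<^sub>0 \<in> ?QC" "\<And>x. x \<in> Q \<Longrightarrow> \<eta>\<^sub>0 x = 1"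
    using Q.principal_character_in by (simp_all add: \<eta>\<^sub>0_def principal_character_def)
  have PC: "\<psi> (x \<otimes> y) = \<psi> x * \<psi> y" if "\<psi> \<in> ?PC" "x \<in> P" "y \<in> P" for \<psi> x y
    using that by (simp add: characters_def mult_character_def)
  have QC: "\<eta> (x \<otimes> y) = \<eta> x * \<eta> y" if "\<eta> \<in> ?QC" "x \<in> Q" "y \<in> Q" for \<eta> x y
    using that by (simp add: characters_def mult_character_def)
  have PC1: "\<psi> \<one> = 1" if "\<psi> \<in> ?PC" for \<psi>
    using that by (simp add: characters_def mult_character_def)
  have QC1: "\<eta> \<one> = 1" if "\<eta> \<in> ?QC" for \<eta>
    using that by (simp add: characters_def mult_character_def)
  have 1: "\<one> \<in> P" "\<one> \<in> Q" by (simp_all add: P_def Q_def)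
  have P9: "\<psi> x ^ 9 = 1" if "\<psi> \<in> ?PC" "x \<in> P" for \<psi> x
    using P.mult_character_power_order[of \<psi> x] that oP by (simp add: characters_def)
  have Qw: "\<eta> x ^ w\<^sup>2 = 1" if "\<eta> \<in> ?QC" "x \<in> Q" for \<eta> x
    using Q.mult_character_power_order[of \<eta> x] that oQ by (simp add: characters_def)
  have finPC: "finite ?PC" and finQC: "finite ?QC"
    using P.finite_characters[OF finP] Q.finite_characters[OF finQ] by auto
  have cPC: "card ?PC = 9" and cQC: "card ?QC = w\<^sup>2"
    using P.card_characters[OF finP] Q.card_characters[OF finQ] oP oQ by auto
  have orthP: "(\<Sum>\<psi>\<in>?PC. \<psi> x) = (if x = \<one> then 9 else 0)" if "x \<in> P" for x
    using P.sum_characters[OF finP, of x] that oP by simp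
  have orthQ: "(\<Sum>\<eta>\<in>?QC. \<eta> x) = (if x = \<one> then (of_nat w)\<^sup>2 else 0)" if "x \<in> Q" for x
    using Q.sum_characters[OF finQ, of x] that oQ by simp

  \<comment> \<open>The value on \<open>D\<close> of the character of \<open>G\<close> whose
    restrictions to \<open>P\<close> and \<open>Q\<close> are \<psi> and \<eta>.\<close>
  define F where "F \<psi> \<eta> = (\<Sum>g\<in>D. \<psi> (g [^] u) * \<eta> (g [^] v))" for \<psi> \<eta> :: "'a \<Rightarrow> complex"
  have char: "mult_character G (\<lambda>g. \<psi> (g [^] u) * \<eta> (g [^] v))" if "\<psi> \<in> ?PC" "\<eta> \<in> ?QC" for \<psi> \<eta>
    using that proj by (simp add: mult_character_def nat_pow_distrib PC QC PC1 QC1)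
  have nontriv: "\<exists>a\<in>carrier G. \<psi> (a [^] u) * \<eta> (a [^] v) \<noteq> 1"
    if \<psi>\<eta>: "\<psi> \<in> ?PC" "\<eta> \<in> ?QC" "\<psi> \<noteq> \<psi>\<^sub>0 \<or> \<eta> \<noteq> \<eta>\<^sub>0" for \<psi> \<eta>
    using \<psi>\<eta>(3)
  proof
    assume "\<psi> \<noteq> \<psi>\<^sub>0"
    then obtain a where "a \<in> P" "\<psi> a \<noteq> 1"
      using P.non_principal_character[OF \<psi>\<eta>(1)] by (auto simp: \<psi>\<^sub>0_def)
    thus ?thesis using Pu[of a] QC1[OF \<psi>\<eta>(2)] by (intro bexI[of _ a]) (auto simp: P_def)
  next
    assume "\<eta> \<noteq> \<eta>\<^sub>0"
    then obtain a where "a \<in> Q" "\<eta> a \<noteq> 1"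
      using Q.non_principal_character[OF \<psi>\<eta>(2)] by (auto simp: \<eta>\<^sub>0_def)
    thus ?thesis using Qv[of a] PC1[OF \<psi>\<eta>(1)] by (intro bexI[of _ a]) (auto simp: Q_def)
  qed
  \<comment> \<open>Off the trivial pair this indicates the value \<open>r - 3 w\<close>; the
    trivial pair has value |D| and is treated separately in \<open>F00\<close>.\<close>
  define c :: "('a \<Rightarrow> complex) \<Rightarrow> ('a \<Rightarrow> complex) \<Rightarrow> nat"
    where "c \<psi> \<eta> = (if F \<psi> \<eta> = of_nat r then 0 else 1)" for \<psi> \<eta>
  have F: "F \<psi> \<eta> = of_nat r - 3 * of_nat w * of_nat (c \<psi> \<eta>)"
    if "\<psi> \<in> ?PC" "\<eta> \<in> ?QC" "\<psi> \<noteq> \<psi>\<^sub>0 \<or> \<eta> \<noteq> \<eta>\<^sub>0" for \<psi> \<eta>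
    using nontriv[OF that] nls_pds_character_sum[OF fin pds char[OF that(1,2)]]
    by (auto simp: F_def c_def)
  have F00: "F \<psi>\<^sub>0 \<eta>\<^sub>0 = of_nat r * (3 * of_nat w + 1)"
    using proj DG D(3) by (simp add: F_def \<psi>0 \<eta>0 algebra_simps)
  have F0: "F \<psi>\<^sub>0 \<eta> = (\<Sum>g\<in>D. \<eta> (g [^] v))" for \<eta>
    unfolding F_def using proj DG by (intro sum.cong refl) (simp add: \<psi>0)

  \<comment> \<open>\<open>g [^] u\<close> and \<open>g [^] v\<close> are the components of \<open>g\<close> in \<open>P\<close> and \<open>Q\<close>, so \<open>E = D \<inter> Q\<close> and \<open>k\<^sub>1 = |D \<inter> P|\<close>.\<close>
  define E where "E = {g \<in> D. g [^] u = \<one>}"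
  define e where "e \<eta> = (\<Sum>g\<in>E. \<eta> (g [^] v))" for \<eta> :: "'a \<Rightarrow> complex"
  define k\<^sub>1 where "k\<^sub>1 = card {g \<in> D. g [^] v = \<one>}"
  have finE: "finite E" and ED: "\<And>g. g \<in> E \<Longrightarrow> g \<in> D" and EG: "\<And>g. g \<in> E \<Longrightarrow> g \<in> carrier G"
    using finD DG by (auto simp: E_def)

  \<comment> \<open>Orthogonality sums over both character groups\<close>
  have sumP: "(\<Sum>\<psi>\<in>?PC. F \<psi> \<eta>) = 9 * e \<eta>" for \<eta>
  proof -
    have "(\<Sum>\<psi>\<in>?PC. F \<psi> \<eta>) = (\<Sum>g\<in>D. \<Sum>\<psi>\<in>?PC. \<psi> (g [^] u) * \<eta> (g [^] v))"
      unfolding F_def by (rule sum.swap)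
    also have "\<dots> = (\<Sum>g\<in>D. if g [^] u = \<one> then 9 * \<eta> (g [^] v) else 0)"
      using proj DG by (intro sum.cong refl) (simp add: orthP flip: sum_distrib_right)
    finally show ?thesis
      using finD by (simp add: e_def E_def sum_distrib_left flip: sum.inter_filter)
  qed
  have sum_e: "(\<Sum>\<eta>\<in>?QC. e \<eta>) = 0"
  proof -
    have "(\<Sum>\<eta>\<in>?QC. e \<eta>) = (\<Sum>g\<in>E. \<Sum>\<eta>\<in>?QC. \<eta> (g [^] v))"
      unfolding e_def by (rule sum.swap)
    also have "\<dots> = (\<Sum>g\<in>E. 0)"
    proof (intro sum.cong refl)
      fix g assume g: "g \<in> E"
      \<comment> \<open>An element of \<open>E\<close> has trivial \<open>P\<close>-component, and
        the identity is not in \<open>D\<close>, so its \<open>Q\<close>-component is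
        nontrivial.\<close>
      hence "g \<noteq> \<one>" using D(2) by (auto simp: E_def)
      hence "g [^] v \<noteq> \<one>" using uv[OF EG[OF g]] g by (auto simp: E_def)
      thus "(\<Sum>\<eta>\<in>?QC. \<eta> (g [^] v)) = 0" using proj EG[OF g] by (simp add: orthQ)
    qed
    finally show ?thesis by simp
  qed
  have sum_e2: "(\<Sum>\<eta>\<in>?QC. (e \<eta>)\<^sup>2) = (of_nat w)\<^sup>2 * of_nat (card E)"
  proof -
    have "(\<Sum>\<eta>\<in>?QC. (e \<eta>)\<^sup>2) = (\<Sum>\<eta>\<in>?QC. \<Sum>g\<in>E. \<Sum>h\<in>E. \<eta> ((g \<otimes> h) [^] v))"
      using proj EG QC
      by (intro sum.cong refl) (simp add: e_def power2_eq_square sum_product nat_pow_distrib)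
    also have "\<dots> = (\<Sum>g\<in>E. \<Sum>\<eta>\<in>?QC. \<Sum>h\<in>E. \<eta> ((g \<otimes> h) [^] v))"
      by (rule sum.swap)
    also have "\<dots> = (\<Sum>g\<in>E. \<Sum>h\<in>E. \<Sum>\<eta>\<in>?QC. \<eta> ((g \<otimes> h) [^] v))"
      by (intro sum.cong refl sum.swap)
    \<comment> \<open>Only mutually inverse pairs survive. As \<open>E\<close> is closed under
      inversion, each \<open>g\<close> contributes exactly one.\<close>
    also have "\<dots> = (\<Sum>g\<in>E. \<Sum>h\<in>E. if h = inv g then (of_nat w)\<^sup>2 else 0)"
    proof (intro sum.cong refl)
      fix g h assume g: "g \<in> E" and h: "h \<in> E"
      have gh: "g \<otimes> h \<in> carrier G" using EG g h by simp
      have "(g \<otimes> h) [^] u = \<one>" using g h EG by (simp add: E_def nat_pow_distrib)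
      hence "(g \<otimes> h) [^] v = \<one> \<longleftrightarrow> g \<otimes> h = \<one>" using uv[OF gh] proj[OF gh] by auto
      also have "\<dots> \<longleftrightarrow> h = inv g" using EG[OF g] EG[OF h] by (metis inv_equality m_comm r_inv)
      finally show "(\<Sum>\<eta>\<in>?QC. \<eta> ((g \<otimes> h) [^] v)) = (if h = inv g then (of_nat w)\<^sup>2 else 0)"
        using proj[OF gh] by (simp add: orthQ)
    qed
    also have "\<dots> = (\<Sum>g\<in>E. (of_nat w)\<^sup>2)"
    proof (intro sum.cong refl)
      fix g assume g: "g \<in> E"
      have "inv g \<in> E" using g D(4) EG[OF g] by (simp add: E_def nat_pow_inv)
      thus "(\<Sum>h\<in>E. if h = inv g then (of_nat w)\<^sup>2 else 0) = ((of_nat w)\<^sup>2 :: complex)"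
        using finE by simp
    qed
    finally show ?thesis by simp
  qed
  have sum_F0: "(\<Sum>\<eta>\<in>?QC. F \<psi>\<^sub>0 \<eta>) = (of_nat w)\<^sup>2 * of_nat k\<^sub>1"
  proof -
    have "(\<Sum>\<eta>\<in>?QC. F \<psi>\<^sub>0 \<eta>) = (\<Sum>g\<in>D. \<Sum>\<eta>\<in>?QC. \<eta> (g [^] v))"
      unfolding F0 by (rule sum.swap)
    also have "\<dots> = (\<Sum>g\<in>D. if g [^] v = \<one> then (of_nat w)\<^sup>2 else 0)"
      using proj DG by (intro sum.cong refl) (simp add: orthQ)
    finally show ?thesis
      using finD by (simp add: k\<^sub>1_def flip: sum.inter_filter)
  qed
  have e0: "e \<eta>\<^sub>0 = of_nat (card E)" using proj EG by (simp add: e_def \<eta>0)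

  \<comment> \<open>Divisibility by 3 and parity of the count \<open>b\<close>\<close>
  define b where "b \<eta> = (\<Sum>\<psi>\<in>?PC. c \<psi> \<eta>)" for \<eta>
  have e_b: "e \<eta> = of_nat r - of_nat w * of_nat (b \<eta>) / 3" if "\<eta> \<in> ?QC" "\<eta> \<noteq> \<eta>\<^sub>0" for \<eta>
  proof -
    have "9 * e \<eta> = (\<Sum>\<psi>\<in>?PC. of_nat r - 3 * of_nat w * of_nat (c \<psi> \<eta>))"
      unfolding sumP[symmetric] using that F by (intro sum.cong refl) auto
    also have "\<dots> = 9 * of_nat r - 3 * of_nat w * of_nat (b \<eta>)"
      by (simp add: sum_subtractf cPC b_def flip: sum_distrib_left)
    also have "\<dots> = 9 * (of_nat r - of_nat w * of_nat (b \<eta>) / 3)" by simp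
    finally show ?thesis by (simp only: mult_cancel_left) simp
  qed
  have b3: "3 dvd b \<eta>" if "\<eta> \<in> ?QC" "\<eta> \<noteq> \<eta>\<^sub>0" for \<eta>
  proof -
    \<comment> \<open>Integrality of \<open>e \<eta>\<close> makes \<open>w * b \<eta> / 3\<close>
      an integer, and 3 is coprime to \<open>w\<close>.\<close>
    have "e \<eta> \<in> cyclotomic_integers (w\<^sup>2)"
      unfolding e_def using that Qw proj EG
      by (intro cyclotomic_integers_sum cyclotomic_integers.root) auto
    moreover have "e \<eta> = of_rat (of_nat r - of_nat w * of_nat (b \<eta>) / 3)"
      using e_b[OF that] by (simp add: of_rat_diff of_rat_divide of_rat_mult)
    ultimately have "of_nat r - of_nat w * of_nat (b \<eta>) / 3 \<in> (\<int> :: rat set)"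
      using rational_cyclotomic_integer_Ints[of "w\<^sup>2"] w0 by simp
    then obtain z where "of_nat r - of_nat w * of_nat (b \<eta>) / 3 = (of_int z :: rat)"
      by (rule Ints_cases)
    hence "(of_int (int (w * b \<eta>)) :: rat) = of_int (3 * (int r - z))" by (simp add: field_simps)
    hence "int (w * b \<eta>) = 3 * (int r - z)" by (simp only: of_int_eq_iff)
    hence "int 3 dvd int (w * b \<eta>)" by simp
    hence "3 dvd w * b \<eta>" by (simp only: int_dvd_int_iff)
    thus ?thesis using cop by (simp add: coprime_dvd_mult_right_iff)
  qed

  \<comment> \<open>The multiplier \<open>s\<close> is -1 modulo 9 and 1 modulo
    \<open>w\<^sup>2\<close>, so raising to the power \<open>s\<close> inverts \<psi> and fixes
    \<eta>.\<close>
  obtain s where s: "[s = 8] (mod 9)" "[s = 1] (mod w\<^sup>2)"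
    using binary_chinese_remainder_nat[OF c9] by blast
  have s0: "0 < s" using s(1) by (auto simp: cong_def intro: gr0I)
  have "coprime s 9" using cong_imp_coprime[OF cong_sym[OF s(1)]]
    by (simp add: coprime_commute eval_nat_numeral)
  moreover have "coprime s (w\<^sup>2)" using cong_imp_coprime[OF cong_sym[OF s(2)]] by simp
  ultimately have cs: "coprime s (order G)" using N by simp
  \<comment> \<open>As 8 is -1 modulo 9, this is the inverse character.\<close>
  define conj where "conj \<psi> = restrict (\<lambda>x. \<psi> x ^ 8) P" for \<psi> :: "'a \<Rightarrow> complex"
  have conj_in: "conj \<psi> \<in> ?PC" if "\<psi> \<in> ?PC" for \<psi>
    using that P.m_closed 1 by (auto simp: conj_def characters_def mult_character_def power_mult_distrib)
  have conj_conj: "conj (conj \<psi>) = \<psi>" if "\<psi> \<in> ?PC" for \<psi>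
  proof (rule P.characters_eqI[OF conj_in[OF conj_in[OF that]] that])
    fix x assume "x \<in> carrier GP"
    hence x: "x \<in> P" by simp
    have "\<psi> x ^ 64 = \<psi> x ^ 1"
      using P9[OF that x] by (rule root_of_unity_power_cong) (simp add: cong_def)
    with x show "conj (conj \<psi>) x = \<psi> x" by (simp add: conj_def flip: power_mult)
  qed
  have conj_fix: "\<psi> = \<psi>\<^sub>0" if "\<psi> \<in> ?PC" "conj \<psi> = \<psi>" for \<psi>
  proof (rule P.characters_eqI[OF that(1) \<psi>0(1)])
    fix x assume "x \<in> carrier GP"
    hence x: "x \<in> P" by simp
    have "\<psi> x ^ 8 = \<psi> x" using fun_cong[OF that(2), of x] x by (simp add: conj_def)
    \<comment> \<open>A character equal to its inverse has values of order dividing both 2 and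
      9.\<close>
    hence "\<psi> x ^ 2 = \<psi> x ^ 9" by (simp add: power2_eq_square eval_nat_numeral)
    hence "\<psi> x = 1"
      using P9[OF that(1) x] coprime_roots_of_unity[of 2 9 "\<psi> x"] by simp
    thus "\<psi> x = \<psi>\<^sub>0 x" using x \<psi>0 by simp
  qed
  have F_conj: "F (conj \<psi>) \<eta> = F \<psi> \<eta>" if "\<psi> \<in> ?PC" "\<eta> \<in> ?QC" "\<eta> \<noteq> \<eta>\<^sub>0" for \<psi> \<eta>
  proof -
    have "F (conj \<psi>) \<eta> = (\<Sum>g\<in>D. (\<psi> (g [^] u) * \<eta> (g [^] v)) ^ s)"
      unfolding F_def
    proof (intro sum.cong refl)
      fix g assume "g \<in> D"
      hence g: "g [^] u \<in> P" "g [^] v \<in> Q" using proj DG by auto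
      have "\<psi> (g [^] u) ^ s = \<psi> (g [^] u) ^ 8" "\<eta> (g [^] v) ^ s = \<eta> (g [^] v) ^ 1"
        using root_of_unity_power_cong[OF P9[OF that(1) g(1)] s(1)]
          root_of_unity_power_cong[OF Qw[OF that(2) g(2)] s(2)] by auto
      thus "conj \<psi> (g [^] u) * \<eta> (g [^] v) = (\<psi> (g [^] u) * \<eta> (g [^] v)) ^ s"
        using g by (simp add: conj_def power_mult_distrib)
    qed
    also have "\<dots> = F \<psi> \<eta>"
      unfolding F_def using nontriv[OF that(1,2)] that(3)
        nls_pds_multiplier[OF fin pds char[OF that(1,2)] _ _ s0 cs] by blast
    finally show ?thesis .
  qed
  have b_even: "even (b \<eta>)" if "\<eta> \<in> ?QC" "\<eta> \<noteq> \<eta>\<^sub>0" "c \<psi>\<^sub>0 \<eta> = 0" for \<eta>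
  proof -
    let ?B = "{\<psi> \<in> ?PC. c \<psi> \<eta> = 1}"
    have "b \<eta> = (\<Sum>\<psi>\<in>?PC. if c \<psi> \<eta> = 1 then 1 else 0)"
      unfolding b_def by (intro sum.cong refl) (auto simp: c_def)
    also have "\<dots> = card ?B" using finPC by (simp flip: sum.inter_filter)
    finally have "b \<eta> = card ?B" .
    \<comment> \<open>Inversion pairs off the characters counted by \<open>b\<close>; its only
      possible fixed point \<open>\<psi>\<^sub>0\<close> is excluded by
      \<open>c \<psi>\<^sub>0 \<eta> = 0\<close>.\<close>
    moreover have "even (card ?B)"
    proof (rule card_even_involution[where f = conj])
      show "conj \<psi> \<in> ?B" if "\<psi> \<in> ?B" for \<psi>
        using that conj_in F_conj[of \<psi> \<eta>] \<open>\<eta> \<in> ?QC\<close> \<open>\<eta> \<noteq> \<eta>\<^sub>0\<close> by (auto simp: c_def)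
      show "conj \<psi> \<noteq> \<psi>" if "\<psi> \<in> ?B" for \<psi>
        using that conj_fix[of \<psi>] \<open>c \<psi>\<^sub>0 \<eta> = 0\<close> by auto
    qed (use finPC conj_conj in auto)
    ultimately show ?thesis by simp
  qed

  have pointwise: "0 \<le> (real (b \<eta>))\<^sup>2 - 6 * real (b \<eta>) + 9 * real (c \<psi>\<^sub>0 \<eta>)"
    if \<eta>: "\<eta> \<in> ?QC" "\<eta> \<noteq> \<eta>\<^sub>0" for \<eta>
  proof -
    obtain j where j: "b \<eta> = 3 * j" using b3[OF \<eta>] by blast
    \<comment> \<open>The expression equals 9 (j^2 - 2 j + c), which could be negative only at j =
      1; there b = 3 is odd, so c = 1.\<close>
    have "j = 0 \<or> j = 1 \<or> 2 \<le> j" by auto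
    moreover have "c \<psi>\<^sub>0 \<eta> = 1" if "j = 1"
      using b_even[OF \<eta>] j that by (auto simp: c_def split: if_splits)
    moreover have "0 \<le> (real (b \<eta>))\<^sup>2 - 6 * real (b \<eta>)" if "2 \<le> j"
      using that j by (simp add: power2_eq_square flip: right_diff_distrib)
    ultimately show ?thesis using j by (elim disjE) auto
  qed
  \<comment> \<open>For \<open>\<eta> \<noteq> \<eta>\<^sub>0\<close> this is \<open>b\<^sup>2 - 6 b + 9 c\<close> scaled by \<open>w\<^sup>2 / 3\<close>, written as a quadratic in \<open>e\<close>.\<close>
  define T where "T \<eta> = 3 * (of_nat r - e \<eta>)\<^sup>2 - 6 * of_nat w * (of_nat r - e \<eta>)
      + of_nat w * (of_nat r - F \<psi>\<^sub>0 \<eta>)" for \<eta>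
  have T: "0 \<le> Re (T \<eta>)" if "\<eta> \<in> ?QC" "\<eta> \<noteq> \<eta>\<^sub>0" for \<eta>
  proof -
    have "T \<eta> = of_real ((real w)\<^sup>2 / 3 * ((real (b \<eta>))\<^sup>2 - 6 * real (b \<eta>) + 9 * real (c \<psi>\<^sub>0 \<eta>)))"
      unfolding T_def e_b[OF that] using that \<psi>0
      by (simp add: F power2_eq_square field_simps)
    thus ?thesis using pointwise[OF that] by (simp only: Re_complex_of_real) simp
  qed

  \<comment> \<open>Summation over the nontrivial characters of \<open>Q\<close>\<close>
  define x y t where "x = real w" and "y = real r" and "t = real (card E)"
  have "(\<Sum>\<eta>\<in>?QC. T \<eta>) = (\<Sum>\<eta>\<in>?QC. (3 * (of_nat r)\<^sup>2 - 5 * of_nat w * of_nat r)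
      + (6 * of_nat w - 6 * of_nat r) * e \<eta> + 3 * (e \<eta>)\<^sup>2 - of_nat w * F \<psi>\<^sub>0 \<eta>)"
    by (intro sum.cong refl) (simp add: T_def power2_eq_square algebra_simps)
  also have "\<dots> = (of_nat w)\<^sup>2 * (3 * (of_nat r)\<^sup>2 - 5 * of_nat w * of_nat r)
      + 3 * ((of_nat w)\<^sup>2 * of_nat (card E)) - of_nat w * ((of_nat w)\<^sup>2 * of_nat k\<^sub>1)"
    by (simp add: sum.distrib sum_subtractf sum_e sum_e2 sum_F0 cQC flip: sum_distrib_left)
  also have "\<dots> = of_real (x\<^sup>2 * (3 * y\<^sup>2 - 5 * x * y + 3 * t - x * real k\<^sub>1))"
    by (simp add: x_def y_def t_def algebra_simps)
  finally have sumT: "(\<Sum>\<eta>\<in>?QC. T \<eta>) = \<dots>" .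
  have T0: "T \<eta>\<^sub>0 = of_real (3 * (y - t)\<^sup>2 - 6 * x * (y - t) - 3 * x\<^sup>2 * y)"
    unfolding T_def e0 F00 by (simp add: x_def y_def t_def power2_eq_square algebra_simps)
  have "0 \<le> Re (\<Sum>\<eta>\<in>?QC - {\<eta>\<^sub>0}. T \<eta>)"
    unfolding Re_sum using T by (intro sum_nonneg) auto
  also have "(\<Sum>\<eta>\<in>?QC - {\<eta>\<^sub>0}. T \<eta>) = (\<Sum>\<eta>\<in>?QC. T \<eta>) - T \<eta>\<^sub>0"
    using finQC \<eta>0 by (simp add: sum_diff1)
  finally have ineq: "0 \<le> x\<^sup>2 * (3 * y\<^sup>2 - 5 * x * y + 3 * t - x * real k\<^sub>1)
      - (3 * (y - t)\<^sup>2 - 6 * x * (y - t) - 3 * x\<^sup>2 * y)"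
    unfolding sumT T0 by (simp only: minus_complex.sel Re_complex_of_real)
  \<comment> \<open>The number of nontrivial \<psi> with value \<open>r - 3 w\<close> when \<eta> is
    trivial. It determines |E| through \<open>sumP\<close> at \<open>\<eta>\<^sub>0\<close>, which
    eliminates \<open>t\<close>.\<close>
  define \<beta> where "\<beta> = (\<Sum>\<psi>\<in>?PC - {\<psi>\<^sub>0}. c \<psi> \<eta>\<^sub>0)"
  have "9 * complex_of_nat (card E) = F \<psi>\<^sub>0 \<eta>\<^sub>0 + (\<Sum>\<psi>\<in>?PC - {\<psi>\<^sub>0}. F \<psi> \<eta>\<^sub>0)"
    unfolding e0[symmetric] sumP[symmetric] using finPC \<psi>0 by (simp add: sum.remove)
  also have "(\<Sum>\<psi>\<in>?PC - {\<psi>\<^sub>0}. F \<psi> \<eta>\<^sub>0) =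
      (\<Sum>\<psi>\<in>?PC - {\<psi>\<^sub>0}. of_nat r - 3 * of_nat w * of_nat (c \<psi> \<eta>\<^sub>0))"
    using F \<eta>0 by (intro sum.cong refl) auto
  also have "\<dots> = 8 * of_nat r - 3 * of_nat w * of_nat \<beta>"
    using finPC \<psi>0 by (simp add: sum_subtractf cPC \<beta>_def flip: sum_distrib_left)
  finally have "complex_of_real (9 * t) =
      of_real (y * (3 * x + 1) + (8 * y - 3 * x * real \<beta>))"
    unfolding F00 by (simp add: x_def y_def t_def)
  hence t: "t = y + x * (y - real \<beta>) / 3"
    unfolding of_real_eq_iff by (simp add: field_simps)
  define z where "z = real \<beta>"
  have "x\<^sup>2 * (3 * y\<^sup>2 - 5 * x * y + 3 * t - x * real k\<^sub>1)
      - (3 * (y - t)\<^sup>2 - 6 * x * (y - t) - 3 * x\<^sup>2 * y) =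
      x\<^sup>2 / 3 * (8 * y\<^sup>2 + 12 * y - 12 * x * y - 3 * x * z + 2 * z * y + 6 * z - z\<^sup>2 - 3 * x * real k\<^sub>1)"
    unfolding t z_def[symmetric] by (simp add: power2_eq_square field_simps)
  from ineq[unfolded this]
  have "0 \<le> 8 * y\<^sup>2 + 12 * y - 12 * x * y - 3 * x * z + 2 * z * y + 6 * z - z\<^sup>2 - 3 * x * real k\<^sub>1"
    using w0 by (subst (asm) zero_le_mult_iff) (simp add: x_def)
  moreover have "0 \<le> 3 * x * real k\<^sub>1" by (simp add: x_def)
  ultimately have "0 \<le> 8 * y\<^sup>2 + 12 * y - 12 * x * y - 3 * x * z + 2 * z * y + 6 * z - z\<^sup>2"
    by linarith
  also have "\<dots> = - (4 * y * (3 * x - 2 * y - 3) + z * (3 * x - 2 * y + z - 6))"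
    by (simp add: power2_eq_square algebra_simps)
  finally have main: "4 * y * (3 * x - 2 * y - 3) + z * (3 * x - 2 * y + z - 6) \<le> 0" by linarith
  \<comment> \<open>If \<open>2 r + 4 \<le> 3 w\<close>, the first summand of \<open>main\<close> is
    at least 4, while the second is at least z (z - 2) = (z - 1)^2 - 1 \<ge> -1; so their sum cannot
    be nonpositive.\<close>
  show ?thesis
  proof (rule ccontr)
    assume "\<not> ?thesis"
    hence "real (2 * r + 4) \<le> real (3 * w)" by (simp only: of_nat_le_iff)
    hence q: "2 * y + 4 \<le> 3 * x" by (simp add: x_def y_def)
    have y1: "1 \<le> y" using r by (simp add: y_def)
    have "4 * 1 \<le> 4 * y * (3 * x - 2 * y - 3)"
      using q y1 mult_mono[of 1 y 1 "3 * x - 2 * y - 3"] by simp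
    moreover have "-1 \<le> z * (3 * x - 2 * y + z - 6)"
    proof -
      have "z * (z - 2) \<le> z * (3 * x - 2 * y + z - 6)"
        using q by (intro mult_left_mono) (auto simp: z_def)
      moreover have "z * (z - 2) = (z - 1)\<^sup>2 - 1" by (simp add: power2_eq_square algebra_simps)
      ultimately show ?thesis using zero_le_power2[of "z - 1"] by linarith
    qed
    ultimately show False using main by linarith
  qed
qed

end

text \<open>With w = m^2, the odd number 3 m^2 lies between 2 r + 1 and 2 r + 3, hence is one of
  these two.\<close>

lemma nls_pds_order_9_fourth_power:
  fixes m r :: nat
  assumes G: "comm_group G" and m: "odd m" "coprime 3 m" and N: "order G = 9 * m ^ 4"
    and r: "1 \<le> r" "real r \<le> (3 * real m ^ 2 - 1) / 2"
    and pds: "nls_pds G D (3 * int m ^ 2) (int r)"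
  shows "real r \<in> {(3 * real m ^ 2 - 1) / 2, (3 * real m ^ 2 - 3) / 2}"
proof -
  have m0: "0 < m" using m(1) by (auto intro: gr0I)
  have "3 * m\<^sup>2 \<le> 2 * r + 3"
    by (rule comm_group.nls_pds_order_9_square[OF G, of "m\<^sup>2" r D])
       (use m m0 N r pds in \<open>simp_all flip: power_mult\<close>)
  moreover have "real (2 * r + 1) \<le> real (3 * m\<^sup>2)" using r(2) by simp
  hence "2 * r + 1 \<le> 3 * m\<^sup>2" by (simp only: of_nat_le_iff)
  moreover have "odd (3 * m\<^sup>2)" using m(1) by simp
  ultimately have "3 * m\<^sup>2 = 2 * r + 1 \<or> 3 * m\<^sup>2 = 2 * r + 3" by presburger
  hence "3 * real m ^ 2 = 2 * real r + 1 \<or> 3 * real m ^ 2 = 2 * real r + 3"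
    by (metis (no_types, opaque_lifting) of_nat_1 of_nat_add of_nat_mult of_nat_numeral of_nat_power)
  thus ?thesis by auto
qed

theorem theorem8:
  shows
  "(\<forall>(G :: ('a, 'b) monoid_scheme) (D :: 'a set) (m :: nat) (r :: nat).
      comm_group G \<and> odd m \<and> m > 0 \<and> coprime 3 m \<and> order G = 9 * m^4 \<and>
      1 \<le> r \<and> real r \<le> (3 * real m^2 - 1) / 2 \<and>
      nls_pds G D (3 * int m^2) (int r)
      \<longrightarrow> real r \<in> {(3 * real m^2 - 3) / 4, (3 * real m^2 + 1) / 4, (3 * real m^2 + 5) / 4,
                    (3 * real m^2 - 5) / 2, (3 * real m^2 - 3) / 2, (3 * real m^2 - 1) / 2})
   \<and>
   (\<forall>(G :: ('a, 'b) monoid_scheme) (D :: 'a set) (p :: nat) (s :: nat) (r :: nat).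
      comm_group G \<and> Factorial_Ring.prime p \<and> p mod 4 = 1 \<and> odd s \<and> s > 0 \<and> order G = 9 * p^(4*s) \<and>
      1 \<le> r \<and> real r \<le> (3 * real p^(2*s) - 1) / 2 \<and>
      nls_pds G D (3 * int p^(2*s)) (int r)
      \<longrightarrow> real r \<in> {(3 * real p^(2*s) + 1) / 4, (3 * real p^(2*s) - 1) / 2,
                    (3 * real p^(2*s) - 3) / 2})"
proof (intro conjI allI impI)
  fix G :: "('a, 'b) monoid_scheme" and D :: "'a set" and m r :: nat
  assume "comm_group G \<and> odd m \<and> m > 0 \<and> coprime 3 m \<and> order G = 9 * m^4 \<and>
      1 \<le> r \<and> real r \<le> (3 * real m^2 - 1) / 2 \<and> nls_pds G D (3 * int m^2) (int r)"
  thus "real r \<in> {(3 * real m^2 - 3) / 4, (3 * real m^2 + 1) / 4, (3 * real m^2 + 5) / 4,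
      (3 * real m^2 - 5) / 2, (3 * real m^2 - 3) / 2, (3 * real m^2 - 1) / 2}"
    using nls_pds_order_9_fourth_power[of G m r D] by blast
next
  fix G :: "('a, 'b) monoid_scheme" and D :: "'a set" and p s r :: nat
  assume *: "comm_group G \<and> Factorial_Ring.prime p \<and> p mod 4 = 1 \<and> odd s \<and> s > 0 \<and>
      order G = 9 * p^(4*s) \<and> 1 \<le> r \<and> real r \<le> (3 * real p^(2*s) - 1) / 2 \<and>
      nls_pds G D (3 * int p^(2*s)) (int r)"
  \<comment> \<open>Part (ii) is the case m = p^s; the congruence modulo 4 makes \<open>p\<close>
    odd and different from 3.\<close>
  have p: "p mod 4 = 1" "Factorial_Ring.prime p" using * by simp_all
  have "odd p" using p(1) by presburger
  moreover have "coprime 3 p"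
    using p by (intro primes_coprime) auto
  ultimately have "odd (p ^ s)" "coprime 3 (p ^ s)" by simp_all
  moreover have "(p ^ s) ^ 4 = p ^ (4 * s)" "real (p ^ s) ^ 2 = real p ^ (2 * s)"
    "int (p ^ s) ^ 2 = int p ^ (2 * s)"
    by (simp_all add: mult.commute flip: power_mult)
  ultimately show "real r \<in> {(3 * real p^(2*s) + 1) / 4, (3 * real p^(2*s) - 1) / 2,
      (3 * real p^(2*s) - 3) / 2}"
    using * nls_pds_order_9_fourth_power[of G "p ^ s" r D] by auto
qed

end
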